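(* For every $n\ge1$, $c_3(n)\equiv c_6(n)\equiv c_{12}(n)\pmod 2$. Moreover: (1) $c_3(2n)\equiv 0\pmod 2$ for all $n\ge1$, and $c_3(4n+1)\equiv c_3(12n+7)\equiv c_3(24n+11)\equiv 0\pmod 2$ for all $n\ge 0$. (2) For every $n\ge1$, $c_3(24n-1)\equiv c_{f_3}(n)\equiv c_{\phi_3}(n)\equiv c_{\phi_6}(n)\equiv c_{2\mu_6}(2n)\equiv p(n)\pmod 2$. (3) For every $n\ge1$, $c_3(24n-9)\equiv c_{\psi_6}(n)\pmod 2$. (4) For $n\ge 0$, $c_3(24n+3)\equiv 1\pmod 2$ if and only if $n=\frac{k(k+1)}{2}$ for some integer $k\ge 0$. (5) For every $n\ge0$, $c_3(12n+3)\equiv c_{\lambda_6}(n)\pmod 2$.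
   Context: Let $q=e^{2\pi i\tau}$, $(a,q)_n=\prod_{k=0}^{n-1}(1-aq^k)$, $(q)_n=(q,q)_n$, with the obvious infinite versions; $\eta_k=q^{k/24}(q^k)_\infty$. Define $j_3=\eta_1^{12}/\eta_3^{12}$, $j_6=\eta_2^3\eta_3^9/(\eta_1^3\eta_6^9)$, $j_{12}=\eta_4^4\eta_6^2/(\eta_2^2\eta_{12}^4)$. Each has an expansion $j_N(\tau)=q^{-1}+a_N+\sum_{n\ge1}c_N(n)q^n$, and $c_N(n)$ denotes the $n$-th Fourier coefficient. For a $q$-series $f(q)$, $c_f(n)$ is the coefficient of $q^n$ in $f$; $p(n)$ is the number of partitions of $n$. The mock theta functions are $f_3(q)=\sum_{n\ge0}\frac{q^{n^2}}{(-q,q)_n^2}$, $\phi_3(q)=\sum_{n\ge0}\frac{q^{n^2}}{(-q^2,q^2)_n}$ (3rd order); $\phi_6(q)=\sum_{n\ge0}\frac{(-1)^n(q,q^2)_nq^{n^2}}{(-q,q)_{2n}}$, $\psi_6(q)=\sum_{n\ge0}\frac{(-1)^nq^{(n+1)^2}(q,q^2)_n}{(-q,q)_{2n+1}}$, $\lambda_6(q)=\sum_{n\ge0}\frac{(-1)^nq^n(q,q^2)_n}{(-q,q)_n}$, $2\mu_6(q)=1+\sum_{n\ge0}\frac{(-1)^nq^{n+1}(1+q^n)(q,q^2)_n}{(-q,q)_{n+1}}$ (6th order); $c_{2\mu_6}(m)$ is the coefficient of $q^m$ in $2\mu_6(q)$. *)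

theory Defs
  imports
    "HOL-Analysis.Analysis"
    "HOL-Computational_Algebra.Formal_Power_Series"
    "HOL-Number_Theory.Cong"
    "HOL-Library.Multiset"
begin

definition qpoch :: "'a::comm_ring_1 \<Rightarrow> 'a \<Rightarrow> nat \<Rightarrow> 'a" where
  "qpoch a q n = (\<Prod>k<n. 1 - a * q ^ k)"

definition qpoch_inf :: "complex \<Rightarrow> complex \<Rightarrow> complex" where
  "qpoch_inf a q = (\<Prod>k. 1 - a * q ^ k)"


definition nome :: "complex \<Rightarrow> complex" where
  "nome \<tau> = exp (2 * of_real pi * \<i> * \<tau>)"

text \<open>The fractional power \<open>q\<^bsup>k/24\<^esup>\<close> is \<open>exp (2 \<pi> i \<tau> k / 24)\<close>.\<close>

definition eta :: "nat \<Rightarrow> complex \<Rightarrow> complex" where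
  "eta k \<tau> = exp (2 * of_real pi * \<i> * \<tau> * of_nat k / 24) * qpoch_inf (nome \<tau> ^ k) (nome \<tau> ^ k)"

definition j3 :: "complex \<Rightarrow> complex" where
  "j3 \<tau> = eta 1 \<tau> ^ 12 / eta 3 \<tau> ^ 12"

definition j6 :: "complex \<Rightarrow> complex" where
  "j6 \<tau> = (eta 2 \<tau> ^ 3 * eta 3 \<tau> ^ 9) / (eta 1 \<tau> ^ 3 * eta 6 \<tau> ^ 9)"

definition j12 :: "complex \<Rightarrow> complex" where
  "j12 \<tau> = (eta 4 \<tau> ^ 4 * eta 6 \<tau> ^ 2) / (eta 2 \<tau> ^ 2 * eta 12 \<tau> ^ 4)"

text \<open>
  \<open>has_q_expansion f c\<close> says that \<open>f \<tau> = q\<^bsup>-1\<^esup> + c 0 + c 1 q + c 2 q\<^sup>2 + \<dots>\<close> on the whole upper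
  half-plane; \<open>c 0\<close> is the constant term and \<open>c n\<close>, for \<open>n \<ge> 1\<close>, the \<open>n\<close>-th Fourier coefficient.
\<close>

definition has_q_expansion :: "(complex \<Rightarrow> complex) \<Rightarrow> (nat \<Rightarrow> complex) \<Rightarrow> bool" where
  "has_q_expansion f c \<longleftrightarrow>
     (\<forall>\<tau>. Im \<tau> > 0 \<longrightarrow> (\<lambda>n. c n * nome \<tau> ^ n) sums (f \<tau> - inverse (nome \<tau>)))"

definition fourier_coeff :: "(complex \<Rightarrow> complex) \<Rightarrow> nat \<Rightarrow> complex" where
  "fourier_coeff f = (THE c. has_q_expansion f c)"

abbreviation c3 :: "nat \<Rightarrow> complex" where "c3 \<equiv> fourier_coeff j3"
abbreviation c6 :: "nat \<Rightarrow> complex" where "c6 \<equiv> fourier_coeff j6"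
abbreviation c12 :: "nat \<Rightarrow> complex" where "c12 \<equiv> fourier_coeff j12"

lemma ex_nome_eq:
  assumes "z \<noteq> 0" "norm z < 1"
  obtains \<tau> where "Im \<tau> > 0" "nome \<tau> = z"
proof
  let ?t = "Ln z / (2 * of_real pi * \<i>)"
  have "Im ?t = - ln (norm z) / (2 * pi)"
    using assms by (simp add: Im_divide power2_eq_square)
  thus "Im ?t > 0"
    using assms by (simp add: divide_neg_pos)
  show "nome ?t = z"
    using assms by (simp add: nome_def)
qed

lemma has_q_expansion_unique:
  assumes "has_q_expansion f c" "has_q_expansion f d"
  shows "c = d"
proof -
  have zero: "(\<lambda>n. (c n - d n) * z ^ n) sums 0" if z: "z \<noteq> 0" "norm z < 1" for z
  proof -
    obtain \<tau> where \<tau>: "Im \<tau> > 0" "nome \<tau> = z"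
      using ex_nome_eq z by blast
    have "(\<lambda>n. c n * z ^ n - d n * z ^ n) sums 0"
      using sums_diff[of "\<lambda>n. c n * z ^ n" _ "\<lambda>n. d n * z ^ n"] assms \<tau>
      unfolding has_q_expansion_def by fastforce
    thus ?thesis
      by (simp add: left_diff_distrib)
  qed
  have "c n - d n = 0" for n
  proof (rule ccontr)
    assume nz: "c n - d n \<noteq> 0"
    define m where "m = (LEAST m. c m - d m \<noteq> 0)"
    have m: "c m - d m \<noteq> 0" and less: "\<And>k. k < m \<Longrightarrow> c k - d k = 0"
      using LeastI[of "\<lambda>m. c m - d m \<noteq> 0", OF nz] not_less_Least[of _ "\<lambda>m. c m - d m \<noteq> 0"]
      unfolding m_def by blast+
    have shift: "(\<lambda>k. (c (k + m) - d (k + m)) * z ^ k) sums 0" if z: "z \<noteq> 0" "norm z < 1" for z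
    proof -
      have "(\<lambda>k. (c (k + m) - d (k + m)) * z ^ (k + m)) sums (0 - (\<Sum>k<m. (c k - d k) * z ^ k))"
        using zero[OF z] by (subst sums_iff_shift) simp_all
      hence "(\<lambda>k. (c (k + m) - d (k + m)) * z ^ (k + m) / z ^ m) sums (0 / z ^ m)"
        using less by (intro sums_divide) simp
      thus ?thesis
        using z by (simp add: power_add)
    qed
    have "((\<lambda>z::complex. 0) \<longlongrightarrow> c (0 + m) - d (0 + m)) (at 0)"
      by (rule powser_limit_0_strong[of 1 "\<lambda>k. c (k + m) - d (k + m)"]) (use shift in auto)
    hence "c (0 + m) - d (0 + m) = 0"
      by (simp add: tendsto_const_iff)
    with m show False by simp
  qed
  thus ?thesis by (auto simp: fun_eq_iff)
qed

lemma fourier_coeff_eqI: "has_q_expansion f c \<Longrightarrow> fourier_coeff f = c"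
  unfolding fourier_coeff_def by (blast intro: has_q_expansion_unique)


text \<open>
  The mock theta functions are formal power series in \<open>q = fps_X\<close>. The infinite sums are taken in
  the topology of coefficientwise stabilisation, and every denominator is a unit with constant
  coefficient 1.
\<close>

definition f_3 :: "complex fps" where
  "f_3 = (\<Sum>n. fps_X ^ (n ^ 2) / (qpoch (- fps_X) fps_X n) ^ 2)"

definition phi_3 :: "complex fps" where
  "phi_3 = (\<Sum>n. fps_X ^ (n ^ 2) / qpoch (- (fps_X ^ 2)) (fps_X ^ 2) n)"

definition phi_6 :: "complex fps" where
  "phi_6 = (\<Sum>n. ((- 1) ^ n * qpoch fps_X (fps_X ^ 2) n * fps_X ^ (n ^ 2))
                 / qpoch (- fps_X) fps_X (2 * n))"

definition psi_6 :: "complex fps" where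
  "psi_6 = (\<Sum>n. ((- 1) ^ n * fps_X ^ ((n + 1) ^ 2) * qpoch fps_X (fps_X ^ 2) n)
                 / qpoch (- fps_X) fps_X (2 * n + 1))"

definition lambda_6 :: "complex fps" where
  "lambda_6 = (\<Sum>n. ((- 1) ^ n * fps_X ^ n * qpoch fps_X (fps_X ^ 2) n)
                    / qpoch (- fps_X) fps_X n)"

text \<open>\<open>two_mu_6\<close> is \<open>2 \<mu>\<^sub>6(q)\<close>, the factor 2 included.\<close>

definition two_mu_6 :: "complex fps" where
  "two_mu_6 = 1 + (\<Sum>n. ((- 1) ^ n * fps_X ^ (n + 1) * (1 + fps_X ^ n) * qpoch fps_X (fps_X ^ 2) n)
                        / qpoch (- fps_X) fps_X (n + 1))"

definition partition_count :: "nat \<Rightarrow> nat" where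
  "partition_count n = card {M :: nat multiset. 0 \<notin># M \<and> sum_mset M = n}"

text \<open>
  All coefficients above are complex numbers that happen to be integers. The congruence below
  asserts integrality of both sides.
\<close>

definition ccong :: "complex \<Rightarrow> complex \<Rightarrow> int \<Rightarrow> bool"
    (\<open>(1[_ \<equiv> _] '(' mod _'))\<close>) where
  "[x \<equiv> y] (mod m) \<longleftrightarrow> (\<exists>a b :: int. x = of_int a \<and> y = of_int b \<and> [a = b] (mod m))"

end

theory Submission
  imports Defs "HOL-Library.Z2" "HOL-Complex_Analysis.Complex_Analysis"
begin

text \<open>
  Everything is reduced to formal power series over the field with two elements, where
  \<open>f(q)\<^sup>2 = f(q\<^sup>2)\<close>. Write \<open>E\<close> for the reduction of \<open>(q)\<^sub>\<infinity>\<close> and \<open>E\<^sub>3 = E(q\<^sup>3)\<close>. Then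
  \<open>q j\<^sub>3 = q j\<^sub>1\<^sub>2 = W\<^sup>4\<close> with \<open>W = E\<^sup>3 / E\<^sub>3\<^sup>3\<close>, and \<open>q j\<^sub>6 = E\<^sup>3 / E\<^sub>3\<^sup>9\<close>, which equals \<open>W\<^sup>4 + q\<close> by
  the identity \<open>E\<^sup>3 E\<^sub>3\<^sup>3 = E\<^sup>1\<^sup>2 + q E\<^sub>3\<^sup>1\<^sup>2\<close>. Modulo 2 the theorems of Gauss and Euler read
  \<open>E\<^sup>3 = \<Sum> q\<^bsup>r(r+1)/2\<^esup>\<close> and \<open>E = \<Sum> q\<^bsup>r(3r+1)/2\<^esup> (1 + q\<^bsup>2r+1\<^esup>)\<close>; sorting triangular numbers modulo 3
  gives \<open>E\<^sup>3 = E\<^sub>3 + q E\<^sub>9\<^sup>3\<close>, hence the 3-dissection of \<open>W\<close>, whose components are \<open>1 / E\<^sup>2\<close>,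
  \<open>Z = E\<^sub>3\<^sup>3 / E\<^sup>3\<close> and 0, and then the 2-dissection of \<open>Z\<close>.

  The third order functions and \<open>\<phi>\<^sub>6\<close> reduce to the Durfee square series of \<open>1 / E\<close>, and \<open>2\<mu>\<^sub>6\<close>
  telescopes to \<open>1 / E\<^sup>2\<close>. For \<open>\<lambda>\<^sub>6\<close> and \<open>\<psi>\<^sub>6\<close> one inserts Bailey pairs relative to \<open>a = q\<close>; modulo 2
  the factors \<open>1 - q\<^bsup>2r+1\<^esup>\<close> of the pair cancel those of the \<open>q\<close>-Gauss sum, so the Hecke-type sum
  collapses to a theta series and yields \<open>Z\<close> and \<open>q E\<^sub>3\<^sup>6 / E\<^sup>3\<close>.
\<close>

text \<open>
  The default simplification rules turn arithmetic on \<open>bit\<close> into Boolean operations and equations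
  between polynomial series into equations between polynomials.
\<close>

declare add_bit_eq_xor [simp del] mult_bit_eq_and [simp del] minus_bit_def [simp del]
  [[simproc del: poly_fps_eq]]

subsection \<open>Formal power series over the field with two elements\<close>

lemma bit_add_self [simp]: "(a::bit) + a = 0"
  by (cases a) (simp_all add: one_add_one)

lemma bit_fps_add_self [simp]: "(f::bit fps) + f = 0"
  by (simp add: fps_eq_iff)

lemma bit_fps_2_eq_0 [simp]: "(2::bit fps) = 0"
  by (metis bit_fps_add_self one_add_one)

lemma bit_fps_add_self_left [simp]: "(f::bit fps) + (f + g) = g"
  by (simp add: add.assoc[symmetric])

lemma bit_fps_uminus [simp]: "- (f::bit fps) = f"
  by (metis bit_fps_add_self minus_unique)

lemma bit_fps_diff [simp]: "(f::bit fps) - g = f + g"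
  by (metis bit_fps_uminus diff_conv_add_uminus)

lemma bit_fps_add_eq_0_iff: "(f::bit fps) + g = 0 \<longleftrightarrow> f = g"
  by (metis add.right_neutral bit_fps_add_self_left bit_fps_add_self)

lemma bit_fps_square_add: "((f::bit fps) + g)\<^sup>2 = f\<^sup>2 + g\<^sup>2"
  by (simp add: power2_eq_square algebra_simps)

lemma fps_nth_compose_X_power:
  assumes "k > 0"
  shows "fps_nth (f oo (fps_X ^ k :: 'a::comm_ring_1 fps)) n = (if k dvd n then fps_nth f (n div k) else 0)"
proof -
  have "fps_nth (f oo (fps_X ^ k)) n = (\<Sum>i = 0..n. fps_nth f i * (if n = k * i then 1 else 0))"
    by (simp add: fps_compose_nth power_mult[symmetric])
  also have "\<dots> = (\<Sum>i = 0..n. if k dvd n \<and> i = n div k then fps_nth f i else 0)"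
    using assms by (intro sum.cong) auto
  also have "\<dots> = (if k dvd n then fps_nth f (n div k) else 0)"
    by auto
  finally show ?thesis .
qed

text \<open>Frobenius on polynomials: over \<open>bit\<close> the cross terms occur twice and
  cancel, and every coefficient is idempotent.\<close>

lemma bit_fps_square_cutoff:
  fixes a :: "nat \<Rightarrow> bit"
  shows "(\<Sum>i<m. fps_const (a i) * fps_X ^ i)\<^sup>2 = (\<Sum>i<m. fps_const (a i) * fps_X ^ (2 * i))"
proof (induction m)
  case (Suc m)
  have [simp]: "(a m)\<^sup>2 = a m" by (cases "a m") auto
  show ?case
    by (simp add: bit_fps_square_add Suc power_mult_distrib power_mult[symmetric] mult.commute)
qed auto

text \<open>Congruence modulo \<open>fps_X ^ (N + 1)\<close>. Limits over \<open>bit\<close> are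
  taken by proving such congruences for every \<open>N\<close>.\<close>

definition fps_agree :: "nat \<Rightarrow> 'a::comm_ring_1 fps \<Rightarrow> 'a fps \<Rightarrow> bool" where
  "fps_agree N f g \<longleftrightarrow> (\<forall>k\<le>N. fps_nth f k = fps_nth g k)"

lemma fps_agree_refl [simp]: "fps_agree N f f"
  by (simp add: fps_agree_def)

lemma fps_agree_sym: "fps_agree N f g \<Longrightarrow> fps_agree N g f"
  by (simp add: fps_agree_def)

lemma fps_agree_trans [trans]: "fps_agree N f g \<Longrightarrow> fps_agree N g h \<Longrightarrow> fps_agree N f h"
  by (simp add: fps_agree_def)

lemma fps_agree_mult:
  "fps_agree N f g \<Longrightarrow> fps_agree N f' g' \<Longrightarrow> fps_agree N (f * f') (g * g')"
  by (auto simp: fps_agree_def fps_mult_nth intro!: sum.cong)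

lemma fps_agree_power: "fps_agree N f g \<Longrightarrow> fps_agree N (f ^ k) (g ^ k)"
  by (induction k) (auto intro: fps_agree_mult)

lemma fps_agree_sum:
  "(\<And>i. i \<in> A \<Longrightarrow> fps_agree N (f i) (g i)) \<Longrightarrow> fps_agree N (sum f A) (sum g A)"
  by (auto simp: fps_agree_def fps_sum_nth intro!: sum.cong)

lemma fps_agree_inverse:
  fixes f g :: "'a::field fps"
  assumes "fps_agree N f g" "fps_nth f 0 \<noteq> 0"
  shows "fps_agree N (inverse f) (inverse g)"
proof -
  have g: "fps_nth g 0 \<noteq> 0" using assms by (auto simp: fps_agree_def)
  have "fps_agree N (inverse f * inverse g * g) (inverse f * inverse g * f)"
    using assms by (intro fps_agree_mult) (auto intro: fps_agree_sym)
  thus ?thesis using assms(2) g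
    by (metis (no_types, lifting) inverse_mult_eq_1 mult.assoc mult.commute mult_1_right)
qed

lemma fps_eqI_agree: "(\<And>N. fps_agree N f g) \<Longrightarrow> f = g"
  by (auto simp: fps_agree_def fps_eq_iff)

lemma fps_agree_X_power_mult: "N < k \<Longrightarrow> fps_agree N (f + fps_X ^ k * g) f"
  by (auto simp: fps_agree_def fps_X_power_mult_nth)

lemma fps_agree_cutoff: "fps_agree N f (\<Sum>i<Suc N. fps_const (fps_nth f i) * fps_X ^ i)"
proof -
  have "(\<Sum>i<Suc N. fps_nth f i * (if k = i then 1 else 0)) = fps_nth f k" if "k \<le> N" for k
  proof -
    have "(\<Sum>i<Suc N. fps_nth f i * (if k = i then 1 else 0)) = (\<Sum>i\<in>{k}. fps_nth f i * (if k = i then 1 else 0))"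
      using that by (intro sum.mono_neutral_right) auto
    thus ?thesis by simp
  qed
  thus ?thesis unfolding fps_agree_def by (simp add: fps_sum_nth)
qed

text \<open>Up to order \<open>N\<close> both sides depend only on the cutoff of \<open>f\<close>,
  where the polynomial case applies.\<close>

lemma bit_fps_square: "(f::bit fps)\<^sup>2 = f oo (fps_X ^ 2)"
proof (rule fps_eqI_agree)
  fix N
  let ?c = "\<Sum>i<Suc N. fps_const (fps_nth f i) * fps_X ^ i"
  have "fps_agree N (f\<^sup>2) (?c\<^sup>2)"
    by (intro fps_agree_power fps_agree_cutoff)
  also have "?c\<^sup>2 = ?c oo (fps_X ^ 2)"
    by (simp add: bit_fps_square_cutoff fps_compose_sum_distrib fps_compose_add_distrib
        fps_compose_mult_distrib fps_X_power_compose power_mult del: sum.lessThan_Suc)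
  also have "fps_agree N \<dots> (f oo (fps_X ^ 2))"
    using fps_agree_cutoff[of N f]
    by (auto simp: fps_agree_def fps_nth_compose_X_power simp del: sum.lessThan_Suc)
  finally show "fps_agree N (f\<^sup>2) (f oo (fps_X ^ 2))" .
qed

lemma bit_fps_square_nth: "fps_nth ((f::bit fps)\<^sup>2) n = (if even n then fps_nth f (n div 2) else 0)"
  by (subst bit_fps_square) (simp add: fps_nth_compose_X_power)

lemma bit_fps_power4_nth: "fps_nth ((f::bit fps) ^ 4) n = (if 4 dvd n then fps_nth f (n div 4) else 0)"
proof -
  have "f ^ 4 = (f\<^sup>2)\<^sup>2" by (simp add: power_mult[symmetric])
  hence "fps_nth (f ^ 4) n = (if even n then if even (n div 2) then fps_nth f (n div 2 div 2) else 0 else 0)"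
    by (simp only: bit_fps_square_nth)
  moreover have "4 dvd n \<longleftrightarrow> even n \<and> even (n div 2)" by presburger
  ultimately show ?thesis by (simp add: div_mult2_eq[symmetric])
qed

subsection \<open>Locally finite sums\<close>

text \<open>
  For ascending families the partial sum up to \<open>N\<close> already determines the \<open>N\<close>-th coefficient of
  the sum.
\<close>

definition ascending :: "(nat \<Rightarrow> 'a::comm_ring_1 fps) \<Rightarrow> bool" where
  "ascending f \<longleftrightarrow> (\<forall>n k. k < n \<longrightarrow> fps_nth (f n) k = 0)"

definition fps_suminf :: "(nat \<Rightarrow> 'a::comm_ring_1 fps) \<Rightarrow> 'a fps" where
  "fps_suminf f = Abs_fps (\<lambda>N. fps_nth (\<Sum>n\<le>N. f n) N)"

lemma ascending_X_power_mult: "(\<And>n. n \<le> e n) \<Longrightarrow> ascending (\<lambda>n. fps_X ^ e n * g n)"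
  unfolding ascending_def fps_X_power_mult_nth by (meson order_less_le_trans)

lemma ascending_if: "ascending f \<Longrightarrow> ascending (\<lambda>n. if P n then f n else 0)"
  by (auto simp: ascending_def)

lemma fps_suminf_agree:
  assumes "ascending f" "N \<le> M"
  shows "fps_agree N (fps_suminf f) (\<Sum>n\<le>M. f n)"
proof -
  have "(\<Sum>n\<le>k. fps_nth (f n) k) = (\<Sum>n\<le>M. fps_nth (f n) k)" if "k \<le> N" for k
    using assms that by (intro sum.mono_neutral_left) (auto simp: ascending_def)
  thus ?thesis by (auto simp: fps_agree_def fps_suminf_def fps_sum_nth)
qed

lemma fps_suminf_eqI:
  assumes "\<And>N. fps_agree N (\<Sum>n\<le>N. f n) g"
  shows "fps_suminf f = g"
  using assms by (auto simp: fps_agree_def fps_suminf_def fps_eq_iff)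

lemma fps_suminf_mult:
  assumes "ascending f"
  shows "fps_suminf (\<lambda>n. g * f n) = g * fps_suminf f"
proof (rule fps_suminf_eqI)
  fix N
  show "fps_agree N (\<Sum>n\<le>N. g * f n) (g * fps_suminf f)"
    unfolding sum_distrib_left[symmetric]
    by (intro fps_agree_mult fps_agree_refl fps_agree_sym[OF fps_suminf_agree] assms) auto
qed

lemma fps_suminf_add: "fps_suminf (\<lambda>n. f n + g n) = fps_suminf f + fps_suminf g"
  by (simp add: fps_suminf_def fps_eq_iff sum.distrib)

lemma fps_suminf_agree_cong:
  assumes "\<And>n. fps_agree N (f n) (g n)"
  shows "fps_agree N (fps_suminf f) (fps_suminf g)"
  using assms by (auto simp: fps_agree_def fps_suminf_def fps_sum_nth intro!: sum.cong)

text \<open>The partial sums are \<open>H (Suc N) - H 0\<close>, and ascent kills the boundary term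
  \<open>H (Suc N)\<close> up to order \<open>N\<close>.\<close>

lemma fps_suminf_telescope:
  fixes H :: "nat \<Rightarrow> 'a::comm_ring_1 fps"
  assumes "ascending H"
  shows "fps_suminf (\<lambda>n. H (Suc n) - H n) = - H 0"
proof (rule fps_suminf_eqI)
  fix N
  have "(\<Sum>n\<le>N. H (Suc n) - H n) = H (Suc N) - H 0"
    by (induction N) auto
  thus "fps_agree N (\<Sum>n\<le>N. H (Suc n) - H n) (- H 0)"
    using assms by (auto simp: fps_agree_def ascending_def)
qed

text \<open>\<open>r \<le> k\<close> makes the partial sum of \<open>g\<close> up to
  \<open>N - r\<close> long enough: only its coefficients up to \<open>N - k\<close> reach order
  \<open>N\<close>.\<close>

lemma fps_suminf_shift:
  fixes g :: "nat \<Rightarrow> 'a::comm_ring_1 fps"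
  assumes "ascending g" "\<And>n. f (n + r) = fps_X ^ k * g n" "\<And>n. n < r \<Longrightarrow> f n = 0"
    and "r \<le> k"
  shows "fps_suminf f = fps_X ^ k * fps_suminf g"
proof (rule fps_suminf_eqI)
  fix N
  show "fps_agree N (\<Sum>n\<le>N. f n) (fps_X ^ k * fps_suminf g)"
  proof (cases "N < r")
    case True
    thus ?thesis using assms by (auto simp: fps_agree_def fps_X_power_mult_nth)
  next
    case False
    then obtain m where N: "N = m + r" by (metis add.commute le_Suc_ex not_less)
    have "{..N} = {..<r} \<union> {r..N}" using N by auto
    hence "(\<Sum>n\<le>N. f n) = (\<Sum>n=r..N. f n)"
      using assms(3) by (simp add: sum.union_disjoint ivl_disj_int)
    also have "\<dots> = (\<Sum>n\<le>m. f (n + r))"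
      unfolding N using sum.shift_bounds_cl_nat_ivl[of f 0 r m] by (simp add: atMost_atLeast0)
    also have "\<dots> = fps_X ^ k * (\<Sum>n\<le>m. g n)"
      by (simp add: assms(2) sum_distrib_left)
    finally show ?thesis
      using fps_suminf_agree[OF assms(1), of m m] \<open>r \<le> k\<close> N
      by (auto simp: fps_agree_def fps_X_power_mult_nth)
  qed
qed

text \<open>Coefficient \<open>N\<close> of either side is a finite sum over
  \<open>r \<le> n \<le> N\<close>, so only a finite exchange takes place.\<close>

lemma fps_suminf_swap:
  fixes t :: "nat \<Rightarrow> nat \<Rightarrow> 'a::comm_ring_1 fps"
  shows "fps_suminf (\<lambda>n. \<Sum>r\<le>n. t n r) = fps_suminf (\<lambda>r. fps_suminf (\<lambda>n. if r \<le> n then t n r else 0))"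
proof (rule fps_ext)
  fix N
  have "(\<Sum>n\<le>N. \<Sum>r\<le>n. fps_nth (t n r) N) = (\<Sum>n\<le>N. \<Sum>r\<le>N. if r \<le> n then fps_nth (t n r) N else 0)"
  proof (rule sum.cong[OF refl])
    fix n assume "n \<in> {..N}"
    hence *: "{..n} = {r \<in> {..N}. r \<le> n}" by auto
    show "(\<Sum>r\<le>n. fps_nth (t n r) N) = (\<Sum>r\<le>N. if r \<le> n then fps_nth (t n r) N else 0)"
      by (subst *) (rule sum.inter_filter, simp)
  qed
  also have "\<dots> = (\<Sum>r\<le>N. \<Sum>n\<le>N. if r \<le> n then fps_nth (t n r) N else 0)"
    by (rule sum.swap)
  finally show "fps_nth (fps_suminf (\<lambda>n. \<Sum>r\<le>n. t n r)) N =
      fps_nth (fps_suminf (\<lambda>r. fps_suminf (\<lambda>n. if r \<le> n then t n r else 0))) N"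
    by (simp add: fps_suminf_def fps_sum_nth if_distrib[of "\<lambda>f. fps_nth f _"] cong: if_cong)
qed

lemma fps_suminf_compose_X_power:
  assumes "ascending f" "k > 0"
  shows "fps_suminf f oo (fps_X ^ k) = fps_suminf (\<lambda>n. f n oo (fps_X ^ k :: 'a::comm_ring_1 fps))"
proof (rule sym, rule fps_suminf_eqI)
  fix N
  have "fps_nth (fps_suminf f) (n div k) = fps_nth (\<Sum>n\<le>N. f n) (n div k)" if "n \<le> N" for n
    using fps_suminf_agree[OF assms(1), of N N] that
    unfolding fps_agree_def by (meson div_le_dividend le_trans order_refl)
  thus "fps_agree N (\<Sum>n\<le>N. f n oo (fps_X ^ k)) (fps_suminf f oo (fps_X ^ k))"
    using assms unfolding fps_compose_sum_distrib[symmetric] by (simp add: fps_agree_def fps_nth_compose_X_power)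
qed

text \<open>Connects the topological sums that define the mock theta functions with
  \<open>fps_suminf\<close>: each coefficient of the partial sums is eventually constant.\<close>

lemma suminf_fps:
  fixes f :: "nat \<Rightarrow> 'a::comm_ring_1 fps"
  assumes "ascending f"
  shows "suminf f = fps_suminf f"
proof -
  have "(\<lambda>n. \<Sum>i<n. f i) \<longlonglongrightarrow> fps_suminf f"
  proof (rule tendsto_fpsI)
    fix n
    show "eventually (\<lambda>m. fps_nth (\<Sum>i<m. f i) n = fps_nth (fps_suminf f) n) sequentially"
      using eventually_gt_at_top[of n]
    proof eventually_elim
      case (elim m)
      then obtain M where "m = Suc M" "n \<le> M" by (cases m) auto
      thus ?case using fps_suminf_agree[OF assms, of n M]
        by (auto simp: fps_agree_def lessThan_Suc_atMost)
    qed
  qed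
  thus ?thesis by (auto simp: sums_def intro: sums_unique[symmetric])
qed

subsection \<open>The \<open>q\<close>-factorials modulo 2\<close>

abbreviation q :: "bit fps" where "q \<equiv> fps_X"

text \<open>
  \<open>Q n\<close>, \<open>R n\<close> and \<open>iQ n\<close> are the reductions of \<open>(q)\<^sub>n\<close>, \<open>(q, q\<^sup>2)\<^sub>n\<close> and \<open>1 / (q)\<^sub>n\<close>; \<open>E\<close> is that of
  \<open>(q)\<^sub>\<infinity>\<close>, whose \<open>n\<close>-th coefficient is already that of \<open>(q)\<^sub>n\<close>. Signs disappear, so \<open>(-q, q)\<^sub>n\<close> also
  reduces to \<open>Q n\<close>, and \<open>(q\<^sup>2, q\<^sup>2)\<^sub>n\<close> to its square.
\<close>

definition Q :: "nat \<Rightarrow> bit fps" where "Q n = qpoch q q n"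
definition R :: "nat \<Rightarrow> bit fps" where "R n = qpoch q (q\<^sup>2) n"
definition iQ :: "nat \<Rightarrow> bit fps" where "iQ n = inverse (Q n)"
definition E :: "bit fps" where "E = Abs_fps (\<lambda>n. fps_nth (Q n) n)"

lemma qpoch_0 [simp]: "qpoch a b 0 = 1"
  and qpoch_Suc: "qpoch a b (Suc n) = qpoch a b n * (1 - a * b ^ n)"
  by (simp_all add: qpoch_def)

lemma Q_0 [simp]: "Q 0 = 1" and R_0 [simp]: "R 0 = 1"
  by (simp_all add: Q_def R_def)

lemma Q_Suc: "Q (Suc n) = Q n * (1 + q * q ^ n)"
  and R_Suc: "R (Suc n) = R n * (1 + q * q ^ n * q ^ n)"
  by (simp_all add: Q_def R_def qpoch_Suc mult_2 power_add mult.assoc flip: power_mult)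

lemma Q_nth_0 [simp]: "fps_nth (Q n) 0 = 1"
  by (induction n) (simp_all add: Q_Suc)

lemma Q_iQ [simp]: "Q n * iQ n = 1"
  by (simp add: iQ_def inverse_mult_eq_1')

lemma Q_iQ_left [simp]: "Q n * (iQ n * f) = f"
  by (simp add: mult.assoc[symmetric])

lemma iQ_0 [simp]: "iQ 0 = 1"
  by (simp add: iQ_def)

lemma iQ_eq_Suc: "iQ n = iQ (Suc n) * (1 + q * q ^ n)"
proof -
  have "iQ n = iQ n * (Q (Suc n) * iQ (Suc n))" by simp
  also have "\<dots> = Q n * iQ n * (iQ (Suc n) * (1 + q * q ^ n))"
    by (simp only: Q_Suc ac_simps)
  finally show ?thesis by simp
qed

lemma qpoch_X2: "qpoch (q\<^sup>2) (q\<^sup>2) n = (Q n)\<^sup>2"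
proof (induction n)
  case (Suc n)
  have "1 + q\<^sup>2 * (q\<^sup>2) ^ n = (1 + q * q ^ n)\<^sup>2"
    by (simp add: bit_fps_square_add power_mult_distrib mult.commute flip: power_mult)
  thus ?case using Suc by (simp add: qpoch_Suc Q_Suc power_mult_distrib)
qed auto

lemma power_double: "(x::'a::monoid_mult) ^ (n * 2) = x ^ n * x ^ n"
  and power_triple: "(x::'a::monoid_mult) ^ (n * 3) = x ^ n * (x ^ n * x ^ n)"
  and power_quadruple: "(x::'a::monoid_mult) ^ (n * 4) = x ^ n * (x ^ n * (x ^ n * x ^ n))"
  by (simp_all add: numeral_eq_Suc power_add)

lemmas power_expand = power_add power_double power_triple power_quadruple mult_2

text \<open>Separate odd and even exponents: the odd factors form \<open>R n\<close>, the even ones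
  \<open>(q^2, q^2)_n\<close>, which is the square of \<open>Q n\<close> modulo 2.\<close>

lemma Q_even: "Q (2 * n) = R n * (Q n)\<^sup>2"
proof (induction n)
  case (Suc n)
  have "1 + q * (q * (q ^ n * q ^ n)) = (1 + q * q ^ n)\<^sup>2"
    by (simp add: power2_eq_square algebra_simps)
  thus ?case using Suc
    by (simp add: Q_Suc R_Suc power_mult_distrib power_expand mult_ac)
qed auto

lemma Q_agree: "N \<le> n \<Longrightarrow> fps_agree N (Q n) E"
proof -
  have step: "fps_agree N (Q (N + k)) (Q N)" for N k
  proof (induction k)
    case (Suc k)
    have "Q (N + Suc k) = Q (N + k) + q ^ (N + Suc k) * Q (N + k)"
      by (simp add: Q_Suc algebra_simps)
    also have "fps_agree N \<dots> (Q (N + k))"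
      by (intro fps_agree_X_power_mult) auto
    finally show ?case using Suc by (blast intro: fps_agree_trans)
  qed auto
  assume "N \<le> n"
  have "fps_nth (Q n) k = fps_nth (Q k) k" if "k \<le> N" for k
    using step[of k "n - k"] \<open>N \<le> n\<close> that by (auto simp: fps_agree_def)
  thus ?thesis by (auto simp: fps_agree_def E_def)
qed

lemma E_nth_0 [simp]: "fps_nth E 0 = 1"
  by (simp add: E_def)

lemma E_inverse [simp]: "E * inverse E = 1" "inverse E * E = 1"
  by (simp_all add: inverse_mult_eq_1 inverse_mult_eq_1')

lemma iQ_agree: "N \<le> n \<Longrightarrow> fps_agree N (iQ n) (inverse E)"
  unfolding iQ_def by (intro fps_agree_inverse Q_agree) auto

lemma R_eq: "R n = Q (2 * n) * (iQ n)\<^sup>2"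
proof -
  have "Q (2 * n) * (iQ n)\<^sup>2 = R n * (Q n * iQ n)\<^sup>2"
    unfolding Q_even by (simp only: power2_eq_square ac_simps)
  thus ?thesis by simp
qed

text \<open>As \<open>n\<close> grows, \<open>R_eq\<close> tends to \<open>E / E^2\<close>. This is
  Euler's \<open>(q, q^2)_\<infinity> (-q, q)_\<infinity> = 1\<close> modulo 2.\<close>

lemma R_agree:
  assumes "N \<le> n"
  shows "fps_agree N (R n) (inverse E)"
proof -
  have "fps_agree N (R n) (E * (inverse E)\<^sup>2)"
    unfolding R_eq using assms by (intro fps_agree_mult fps_agree_power Q_agree iQ_agree) auto
  thus ?thesis by (simp add: power2_eq_square flip: mult.assoc)
qed

subsection \<open>Terminating sums by the Wilf--Zeilberger method\<close>

text \<open>Summed over \<open>r \<le> n\<close>, the first hypothesis telescopes to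
  \<open>G n (Suc n)\<close>, which cancels the new diagonal term \<open>F (Suc n) (Suc n)\<close>;
  so the sum does not depend on \<open>n\<close>. The index \<open>m + r\<close> encodes
  \<open>r \<le> n\<close> without subtraction.\<close>

lemma wz_sum:
  fixes F G :: "nat \<Rightarrow> nat \<Rightarrow> bit fps"
  assumes "\<And>m r. F (Suc (m + r)) r + F (m + r) r = G (m + r) (Suc r) + G (m + r) r"
    and "\<And>n. G n 0 = 0" "\<And>n. F (Suc n) (Suc n) = G n (Suc n)"
  shows "(\<Sum>r\<le>n. F n r) = F 0 0"
proof (induction n)
  case (Suc n)
  have "F (Suc n) r = F n r + (G n (Suc r) + G n r)" if "r \<le> n" for r
    using assms(1)[of "n - r" r, symmetric] that by (simp add: add.left_commute)
  hence "(\<Sum>r\<le>n. F (Suc n) r) = (\<Sum>r\<le>n. F n r) + (\<Sum>r\<le>n. G n (Suc r) + G n r)"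
    unfolding sum.distrib[symmetric] by (intro sum.cong) auto
  also have "(\<Sum>r\<le>k. G n (Suc r) + G n r) = G n (Suc k)" for k
    by (induction k) (simp_all add: assms(2) ac_simps)
  finally show ?case using Suc assms(3)[of n] by (simp add: add.assoc)
qed auto

text \<open>Pentagonal numbers; those of the second kind, \<open>r (3 r + 1) / 2\<close>, appear as
  \<open>pent r + r\<close>.\<close>

definition pent :: "nat \<Rightarrow> nat" where "pent r = r * (3 * r - 1) div 2"

lemma pent_0 [simp]: "pent 0 = 0"
  by (simp add: pent_def)

lemma pent_Suc: "pent (Suc r) = pent r + 3 * r + 1"
proof -
  have "Suc r * (3 * Suc r - 1) = r * (3 * r - 1) + 2 * (3 * r + 1)"
    by (cases r) (auto simp: algebra_simps)
  thus ?thesis unfolding pent_def by (simp add: add.assoc)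
qed

text \<open>
  In \<open>bailey_pentagonal\<close> and \<open>bailey_triangular\<close>, \<open>1 / (q)\<^sub>n\<close> and \<open>1 / (q)\<^bsub>2n+1\<^esub>\<close> are the \<open>\<beta>\<close>-sides of Bailey pairs
  relative to \<open>a = q\<close> in base \<open>q\<close>, respectively \<open>a = q\<^sup>2\<close> in base \<open>q\<^sup>2\<close>.
\<close>

lemma bailey_pentagonal:
  "iQ n = (\<Sum>r\<le>n. q ^ (pent r + r) * (1 + q ^ (2 * r + 1)) * iQ (n - r) * iQ (n + r + 1))"
proof -
  \<comment> \<open>\<open>F\<close> is the summand divided by the claimed value
    \<open>iQ n\<close>, so that its sum should be 1; \<open>G\<close> is its Wilf--Zeilberger
    certificate.\<close>
  define F where "F = (\<lambda>n r. q ^ (pent r + r) * (1 + q ^ (2 * r + 1)) * Q n * iQ (n - r) * iQ (n + r + 1))"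
  define G where "G = (\<lambda>n r. q ^ (n + 1) * q ^ pent r * (1 + q ^ r) * Q n * iQ (n + 1 - r) * iQ (n + r + 1))"
  have "(\<Sum>r\<le>n. F n r) = F 0 0"
  proof (rule wz_sum)
    fix m r :: nat
    define e a b where "e = q ^ pent r" and "a = q ^ m" and "b = q ^ r"
    \<comment> \<open>\<open>J\<close> carries the smallest \<open>Q\<close> and the largest
      \<open>iQ\<close> indices that occur, so each of the four terms is a polynomial in
      \<open>q\<close>, \<open>e\<close>, \<open>a\<close>, \<open>b\<close> times
      \<open>J\<close>.\<close>
    define J where "J = Q (m + r) * iQ (Suc m) * iQ (Suc (Suc (m + r + r)))"
    have 1: "F (m + r) r = e * b * (1 + q * b * b) * (1 + q * a) * (1 + q * q * a * b * b) * J"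
      unfolding F_def J_def e_def a_def b_def
      by (simp add: iQ_eq_Suc[of m] iQ_eq_Suc[of "Suc (m + r + r)"] power_expand mult_ac)
    have 2: "F (Suc (m + r)) r = e * b * (1 + q * b * b) * (1 + q * a * b) * J"
      unfolding F_def J_def e_def a_def b_def
      by (simp add: Suc_diff_le Q_Suc power_expand mult_ac)
    have 3: "G (m + r) r = q * a * b * e * (1 + b) * (1 + q * q * a * b * b) * J"
      unfolding G_def J_def e_def a_def b_def
      by (simp add: Suc_diff_le iQ_eq_Suc[of "Suc (m + r + r)"] power_expand mult_ac)
    have 4: "G (m + r) (Suc r) = q * a * b * e * b * b * b * q * (1 + q * b) * (1 + q * a) * J"
      unfolding G_def J_def e_def a_def b_def
      by (simp add: iQ_eq_Suc[of m] pent_Suc power_expand mult_ac)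
    show "F (Suc (m + r)) r + F (m + r) r = G (m + r) (Suc r) + G (m + r) r"
      unfolding 1 2 3 4 by (simp add: algebra_simps)
  next
    fix n
    show "G n 0 = 0" by (simp add: G_def)
    show "F (Suc n) (Suc n) = G n (Suc n)"
      unfolding F_def G_def
      by (simp add: Q_Suc iQ_eq_Suc[of "Suc (Suc (n + n))"] power_expand mult_ac)
  qed
  also have "F 0 0 = 1"
    using Q_iQ[of 1] by (simp add: F_def Q_Suc)
  finally have "iQ n * 1 = iQ n * (\<Sum>r\<le>n. F n r)" by simp
  also have "\<dots> = (\<Sum>r\<le>n. Q n * (iQ n * (q ^ (pent r + r) * (1 + q ^ (2 * r + 1)) * iQ (n - r) * iQ (n + r + 1))))"
    unfolding F_def sum_distrib_left by (simp only: ac_simps)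
  finally show ?thesis by simp
qed

lemma bailey_triangular:
  "iQ (2 * n + 1) = (\<Sum>r\<le>n. q ^ (2 * r ^ 2 + r) * (1 + q ^ (2 * r + 1)) * (iQ (n - r))\<^sup>2 * (iQ (n + r + 1))\<^sup>2)"
proof -
  define F where "F = (\<lambda>n r. q ^ (2 * r ^ 2 + r) * (1 + q ^ (2 * r + 1)) * Q (2 * n + 1) * (iQ (n - r))\<^sup>2 * (iQ (n + r + 1))\<^sup>2)"
  define G where "G = (\<lambda>n r. q ^ (2 * n + 2) * q ^ (2 * r ^ 2 - r) * (1 + q ^ (2 * r)) * Q (2 * n + 1) * (iQ (n + 1 - r))\<^sup>2 * (iQ (n + r + 1))\<^sup>2)"
  have "(\<Sum>r\<le>n. F n r) = F 0 0"
  proof (rule wz_sum)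
    fix m r :: nat
    define e a b where "e = q ^ (2 * r ^ 2 - r)" and "a = q ^ m" and "b = q ^ r"
    define J where "J = Q (2 * (m + r) + 1) * (iQ (Suc m))\<^sup>2 * (iQ (Suc (Suc (m + r + r))))\<^sup>2"
    \<comment> \<open>Splitting off \<open>r\<close> keeps the truncated difference as one atom, the
      exponent of \<open>e\<close>.\<close>
    have r: "2 * r ^ 2 = (2 * r ^ 2 - r) + r" by (cases r) (auto simp: power2_eq_square)
    have rS: "2 * (Suc r) ^ 2 - Suc r = (2 * r ^ 2 - r) + 4 * r + 1"
      by (cases r) (auto simp: power2_eq_square)
    have 1: "F (m + r) r = e * b * b * (1 + q * b * b) * (1 + q * a)\<^sup>2 * (1 + q * q * a * b * b)\<^sup>2 * J"
      unfolding F_def J_def e_def a_def b_def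
      by (subst r) (simp add: iQ_eq_Suc[of m] iQ_eq_Suc[of "Suc (m + r + r)"] power_expand power_mult_distrib mult_ac)
    have 2: "F (Suc (m + r)) r = e * b * b * (1 + q * b * b) * (1 + q * q * a * b * a * b) * (1 + q * q * q * a * b * a * b) * J"
      unfolding F_def J_def e_def a_def b_def
      by (subst r) (simp add: Suc_diff_le Q_Suc power_expand mult_ac)
    have 3: "G (m + r) r = q * q * a * b * a * b * e * (1 + b * b) * (1 + q * q * a * b * b)\<^sup>2 * J"
      unfolding G_def J_def e_def a_def b_def
      by (simp add: Suc_diff_le iQ_eq_Suc[of "Suc (m + r + r)"] power_expand power_mult_distrib mult_ac)
    have 4: "G (m + r) (Suc r) = q * q * a * b * a * b * e * b * b * b * b * q * (1 + q * q * b * b) * (1 + q * a)\<^sup>2 * J"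
      unfolding G_def J_def e_def a_def b_def rS
      by (simp add: iQ_eq_Suc[of m] power_expand power_mult_distrib mult_ac)
    show "F (Suc (m + r)) r + F (m + r) r = G (m + r) (Suc r) + G (m + r) r"
      unfolding 1 2 3 4 by (simp add: power2_eq_square algebra_simps)
  next
    fix n :: nat
    show "G n 0 = 0" by (simp add: G_def)
    obtain e where r: "2 * (Suc n) ^ 2 = e + Suc n" "2 * (Suc n) ^ 2 - Suc n = e"
      by (rule that[of "2 * (Suc n) ^ 2 - Suc n"]) (simp_all add: power2_eq_square)
    show "F (Suc n) (Suc n) = G n (Suc n)"
      unfolding F_def G_def r
      by (simp add: Q_Suc iQ_eq_Suc[of "Suc (Suc (n + n))"] power_expand power2_eq_square mult_ac)
  qed
  also have "F 0 0 = 1"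
    using iQ_eq_Suc[of 0] by (simp add: F_def Q_Suc power2_eq_square mult_ac)
  finally have "iQ (2 * n + 1) * 1 = iQ (2 * n + 1) * (\<Sum>r\<le>n. F n r)" by simp
  also have "\<dots> = (\<Sum>r\<le>n. Q (2 * n + 1) * (iQ (2 * n + 1) * (q ^ (2 * r ^ 2 + r) * (1 + q ^ (2 * r + 1)) * (iQ (n - r))\<^sup>2 * (iQ (n + r + 1))\<^sup>2)))"
    unfolding F_def sum_distrib_left by (simp only: ac_simps)
  finally show ?thesis by simp
qed

text \<open>Divided by \<open>iQ n\<close>, this counts partitions with at most \<open>n\<close>
  parts by the side \<open>k\<close> of their Durfee square: at most \<open>k\<close> parts to its
  right, and a partition in a \<open>k\<close> by \<open>n - k\<close> box below.\<close>

lemma durfee_sum: "(iQ n)\<^sup>2 = (\<Sum>k\<le>n. q ^ (k ^ 2) * (iQ k)\<^sup>2 * iQ (n - k))"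
proof -
  define F where "F = (\<lambda>n k. q ^ (k ^ 2) * (Q n)\<^sup>2 * (iQ k)\<^sup>2 * iQ (n - k))"
  \<comment> \<open>Truncated subtraction would turn \<open>iQ (k - 1)\<close> at
    \<open>k = 0\<close> into 1, whereas the reciprocal factorial of index -1 has to vanish; hence
    the separate case.\<close>
  define G where "G = (\<lambda>n k. if k = 0 then 0 else q ^ (k ^ 2 - k + n + 1) * (Q n)\<^sup>2 * (iQ (k - 1))\<^sup>2 * iQ (n + 1 - k))"
  have "(\<Sum>r\<le>n. F n r) = F 0 0"
  proof (rule wz_sum)
    fix m r :: nat
    define e a b where "e = q ^ (r ^ 2 - r)" and "a = q ^ m" and "b = q ^ r"
    define J where "J = (Q (m + r))\<^sup>2 * (iQ r)\<^sup>2 * iQ (Suc m)"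
    have r: "r ^ 2 = (r ^ 2 - r) + r" by (cases r) (auto simp: power2_eq_square)
    have rS: "(Suc r) ^ 2 - Suc r = (r ^ 2 - r) + 2 * r"
      by (cases r) (auto simp: power2_eq_square)
    have 1: "F (m + r) r = e * b * (1 + q * a) * J"
      unfolding F_def J_def e_def a_def b_def
      by (subst r) (simp add: iQ_eq_Suc[of m] power_expand mult_ac)
    have 2: "F (Suc (m + r)) r = e * b * (1 + q * a * b)\<^sup>2 * J"
      unfolding F_def J_def e_def a_def b_def
      by (subst r) (simp add: Suc_diff_le Q_Suc power_expand power_mult_distrib mult_ac)
    have 3: "G (m + r) r = q * a * b * e * (1 + b)\<^sup>2 * J"
    proof (cases r)
      case 0
      thus ?thesis by (simp add: G_def b_def)
    next
      case (Suc s)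
      thus ?thesis unfolding G_def J_def e_def a_def b_def
        by (simp add: iQ_eq_Suc[of s] power_expand power_mult_distrib mult_ac)
    qed
    have 4: "G (m + r) (Suc r) = q * a * b * e * b * b * (1 + q * a) * J"
      unfolding G_def J_def e_def a_def b_def rS
      by (simp add: iQ_eq_Suc[of m] power_expand power_mult_distrib mult_ac)
    show "F (Suc (m + r)) r + F (m + r) r = G (m + r) (Suc r) + G (m + r) r"
      unfolding 1 2 3 4 by (simp add: power2_eq_square algebra_simps)
  next
    fix n :: nat
    show "G n 0 = 0" by (simp add: G_def)
    have r: "(Suc n) ^ 2 = ((Suc n) ^ 2 - Suc n) + Suc n" by (simp add: power2_eq_square)
    show "F (Suc n) (Suc n) = G n (Suc n)"
      unfolding F_def G_def
      by (subst r) (simp add: Q_Suc iQ_eq_Suc[of n] power_mult_distrib power_expand mult_ac)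
  qed
  also have "F 0 0 = 1" by (simp add: F_def)
  finally have "(iQ n)\<^sup>2 * 1 = (iQ n)\<^sup>2 * (\<Sum>r\<le>n. F n r)" by simp
  also have "\<dots> = (\<Sum>k\<le>n. Q n * (iQ n * (Q n * (iQ n * (q ^ (k ^ 2) * (iQ k)\<^sup>2 * iQ (n - k))))))"
    unfolding F_def sum_distrib_left power2_eq_square by (simp only: ac_simps)
  finally show ?thesis by simp
qed

subsection \<open>Theta series modulo 2\<close>

lemma fps_agree_X_power_left:
  assumes "e \<le> N \<Longrightarrow> fps_agree N f g"
  shows "fps_agree N (fps_X ^ e * f) (fps_X ^ e * g)"
proof (cases "e \<le> N")
  case True
  thus ?thesis using assms by (intro fps_agree_mult) auto
qed (auto simp: fps_agree_def fps_X_power_mult_nth)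

text \<open>Passage to the limit in a finite Bailey sum. In the applications \<open>h r\<close>
  involves \<open>iQ (2 * N - r)\<close>, whose index is at least \<open>N\<close> for
  \<open>r \<le> N\<close>; for larger \<open>r\<close> the factor \<open>q ^ e r\<close> hides
  \<open>h r\<close>.\<close>

lemma bailey_limit:
  assumes "\<And>r. r \<le> e r" "\<And>r. r \<le> N \<Longrightarrow> fps_agree N (h r) H"
  shows "fps_agree N (\<Sum>r\<le>2 * N. q ^ e r * (g r * h r)) (H * fps_suminf (\<lambda>r. q ^ e r * g r))"
proof -
  have "fps_agree N (\<Sum>r\<le>2 * N. q ^ e r * (g r * h r)) (\<Sum>r\<le>2 * N. q ^ e r * (g r * H))"
    using assms by (intro fps_agree_sum fps_agree_X_power_left fps_agree_mult fps_agree_refl)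
      (meson le_trans)
  also have "(\<Sum>r\<le>2 * N. q ^ e r * (g r * H)) = H * (\<Sum>r\<le>2 * N. q ^ e r * g r)"
    by (simp add: sum_distrib_left mult_ac)
  also have "fps_agree N \<dots> (H * fps_suminf (\<lambda>r. q ^ e r * g r))"
    using assms(1)
    by (intro fps_agree_mult fps_agree_refl fps_agree_sym[OF fps_suminf_agree] ascending_X_power_mult) auto
  finally show ?thesis .
qed

lemma fps_suminf_pairs:
  assumes "ascending f"
  shows "fps_suminf (\<lambda>r. f (2 * r) + f (2 * r + 1)) = fps_suminf f"
proof (rule fps_suminf_eqI)
  fix N
  have "(\<Sum>r\<le>M. f (2 * r) + f (2 * r + 1)) = (\<Sum>r\<le>2 * M + 1. f r)" for M
    by (induction M) (auto simp: algebra_simps)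
  thus "fps_agree N (\<Sum>r\<le>N. f (2 * r) + f (2 * r + 1)) (fps_suminf f)"
    by (simp only:) (intro fps_agree_sym[OF fps_suminf_agree] assms, simp)
qed

lemma fps_suminf_triples:
  assumes "ascending f"
  shows "fps_suminf (\<lambda>r. f (3 * r) + f (3 * r + 1) + f (3 * r + 2)) = fps_suminf f"
proof (rule fps_suminf_eqI)
  fix N
  have "(\<Sum>r\<le>M. f (3 * r) + f (3 * r + 1) + f (3 * r + 2)) = (\<Sum>r\<le>3 * M + 2. f r)" for M
    by (induction M) (auto simp: algebra_simps numeral_eq_Suc)
  thus "fps_agree N (\<Sum>r\<le>N. f (3 * r) + f (3 * r + 1) + f (3 * r + 2)) (fps_suminf f)"
    by (simp only:) (intro fps_agree_sym[OF fps_suminf_agree] assms, simp)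
qed

section \<open>Triangular numbers and the theta series of Gauss and Euler\<close>

definition tri :: "nat \<Rightarrow> nat" where "tri r = r * (r + 1) div 2"

lemma tri_0 [simp]: "tri 0 = 0" and tri_Suc: "tri (Suc r) = tri r + Suc r"
  by (auto simp: tri_def)

lemma tri_ge: "r \<le> tri r"
  by (induction r) (auto simp: tri_Suc)

lemma tri_ge_mult: "k > 0 \<Longrightarrow> r \<le> k * tri r"
  by (rule order_trans[OF tri_ge]) simp

lemma strict_mono_tri: "strict_mono tri"
  by (rule strict_monoI_Suc) (simp add: tri_Suc)

lemma tri_even: "tri (2 * r) = 2 * r ^ 2 + r"
  and tri_odd: "tri (2 * r + 1) = 2 * r ^ 2 + r + (2 * r + 1)"
  by (induction r) (auto simp: tri_Suc power2_eq_square)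

lemma tri_3: "tri (3 * r) = 3 * (pent r + r)"
  and tri_3_1: "tri (3 * r + 1) = 9 * tri r + 1"
  and tri_3_2: "tri (3 * r + 2) = 3 * (pent r + r + (2 * r + 1))"
  by (induction r) (auto simp: tri_Suc pent_Suc numeral_eq_Suc)

text \<open>Exponents of the \<open>lambda_6\<close> sum: \<open>pent r + r\<close> comes from the
  Bailey pair, the last \<open>r\<close> from the Gauss sum.\<close>

lemma pent_tri: "pent r + r + r = 3 * tri r"
  by (induction r) (auto simp: tri_Suc pent_Suc)

definition psi :: "bit fps" where "psi = fps_suminf (\<lambda>r. q ^ tri r)"

lemma ascending_X_power: "(\<And>n. n \<le> e n) \<Longrightarrow> ascending (\<lambda>n. fps_X ^ e n)"
  using ascending_X_power_mult[of e "\<lambda>_. 1"] by simp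

lemma ascending_tri: "ascending (\<lambda>r. q ^ tri r)"
  by (intro ascending_X_power tri_ge)

text \<open>\<open>tri\<close> is injective, so no two terms of the series cancel modulo 2.\<close>

lemma psi_nth: "fps_nth psi n = (if \<exists>k. n = tri k then 1 else 0)"
proof -
  have eq: "fps_nth psi n = (\<Sum>r\<le>n. if n = tri r then 1 else 0)"
    by (simp add: psi_def fps_suminf_def fps_sum_nth)
  show ?thesis
  proof (cases "\<exists>k. n = tri k")
    case True
    then obtain k where k: "n = tri k" by blast
    have "(n = tri r) = (r = k)" for r
      using k by (auto simp: strict_mono_eq[OF strict_mono_tri])
    hence "fps_nth psi n = (\<Sum>r\<le>n. if r = k then 1 else 0)"
      unfolding eq by simp
    thus ?thesis using k tri_ge[of k] by auto
  qed (auto simp: eq)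
qed

text \<open>In \<open>bailey_triangular\<close> the left side tends to \<open>1 / E\<close> and the
  reciprocal factors to \<open>1 / E^4\<close>. The two terms of the remaining series are those of
  \<open>psi\<close> with even and odd argument of \<open>tri\<close>.\<close>

lemma E_cubed: "E ^ 3 = psi"
proof -
  have "inverse E = (inverse E) ^ 4 * fps_suminf (\<lambda>r. q ^ (2 * r ^ 2 + r) * (1 + q ^ (2 * r + 1)))"
  proof (rule fps_eqI_agree)
    fix N
    have "fps_agree N (inverse E) (iQ (2 * (2 * N) + 1))"
      by (intro fps_agree_sym[OF iQ_agree]) auto
    also have "iQ (2 * (2 * N) + 1) = (\<Sum>r\<le>2 * N. q ^ (2 * r ^ 2 + r) *
        ((1 + q ^ (2 * r + 1)) * ((iQ (2 * N - r))\<^sup>2 * (iQ (2 * N + r + 1))\<^sup>2)))"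
      by (subst bailey_triangular) (simp only: mult.assoc)
    also have "fps_agree N \<dots> (((inverse E)\<^sup>2 * (inverse E)\<^sup>2) *
        fps_suminf (\<lambda>r. q ^ (2 * r ^ 2 + r) * (1 + q ^ (2 * r + 1))))"
      by (intro bailey_limit fps_agree_mult fps_agree_power iQ_agree) auto
    finally show "fps_agree N (inverse E) ((inverse E) ^ 4 *
        fps_suminf (\<lambda>r. q ^ (2 * r ^ 2 + r) * (1 + q ^ (2 * r + 1))))"
      by (simp add: power_add[symmetric])
  qed
  also have "fps_suminf (\<lambda>r. q ^ (2 * r ^ 2 + r) * (1 + q ^ (2 * r + 1))) = psi"
    unfolding psi_def fps_suminf_pairs[OF ascending_tri, symmetric] tri_even tri_odd
    by (simp only: distrib_left power_add mult_1_right)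
  finally have "E ^ 4 * inverse E = E ^ 4 * ((inverse E) ^ 4 * psi)"
    by (rule arg_cong)
  also have "\<dots> = (E * inverse E) ^ 4 * psi"
    by (simp only: power_mult_distrib mult.assoc)
  finally have "E ^ 4 * inverse E = (E * inverse E) ^ 4 * psi" .
  moreover have "E ^ 4 * inverse E = E ^ 3 * (E * inverse E)"
    by (simp add: numeral_eq_Suc mult_ac)
  ultimately show ?thesis by simp
qed

text \<open>The same limit of \<open>bailey_pentagonal\<close>, where only two reciprocal factors
  occur.\<close>

lemma E_pentagonal: "E = fps_suminf (\<lambda>r. q ^ (pent r + r) * (1 + q ^ (2 * r + 1)))"
proof -
  have "inverse E = (inverse E) ^ 2 * fps_suminf (\<lambda>r. q ^ (pent r + r) * (1 + q ^ (2 * r + 1)))"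
  proof (rule fps_eqI_agree)
    fix N
    have "fps_agree N (inverse E) (iQ (2 * N))"
      by (intro fps_agree_sym[OF iQ_agree]) auto
    also have "iQ (2 * N) = (\<Sum>r\<le>2 * N. q ^ (pent r + r) *
        ((1 + q ^ (2 * r + 1)) * (iQ (2 * N - r) * iQ (2 * N + r + 1))))"
      by (subst bailey_pentagonal) (simp only: mult.assoc)
    also have "fps_agree N \<dots> ((inverse E * inverse E) *
        fps_suminf (\<lambda>r. q ^ (pent r + r) * (1 + q ^ (2 * r + 1))))"
      by (intro bailey_limit fps_agree_mult iQ_agree) auto
    finally show "fps_agree N (inverse E) ((inverse E) ^ 2 *
        fps_suminf (\<lambda>r. q ^ (pent r + r) * (1 + q ^ (2 * r + 1))))"
      by (simp add: power2_eq_square)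
  qed
  hence "E ^ 2 * inverse E = E ^ 2 * ((inverse E) ^ 2 * fps_suminf (\<lambda>r. q ^ (pent r + r) * (1 + q ^ (2 * r + 1))))"
    by (rule arg_cong)
  also have "\<dots> = (E * inverse E) ^ 2 * fps_suminf (\<lambda>r. q ^ (pent r + r) * (1 + q ^ (2 * r + 1)))"
    by (simp only: power_mult_distrib mult.assoc)
  finally have "E ^ 2 * inverse E = (E * inverse E) ^ 2 * fps_suminf (\<lambda>r. q ^ (pent r + r) * (1 + q ^ (2 * r + 1)))" .
  moreover have "E ^ 2 * inverse E = E * (E * inverse E)"
    by (simp add: power2_eq_square mult_ac)
  ultimately show ?thesis by simp
qed

lemma X_power_compose_X_power: "k > 0 \<Longrightarrow> q ^ m oo q ^ k = q ^ (k * m)"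
  by (simp add: fps_X_power_compose flip: power_mult)

text \<open>Sort by the argument of \<open>tri\<close> modulo 3: residues 0 and 2 give three times
  the exponents of \<open>E_pentagonal\<close>, residue 1 gives
  \<open>9 * tri r + 1\<close>.\<close>

lemma psi_dissection: "psi = (E oo q ^ 3) + q * (psi oo q ^ 9)"
proof -
  have "psi = fps_suminf (\<lambda>r. q ^ tri (3 * r) + q ^ tri (3 * r + 1) + q ^ tri (3 * r + 2))"
    unfolding psi_def by (rule fps_suminf_triples[OF ascending_tri, symmetric])
  also have "\<dots> = fps_suminf (\<lambda>r. (q ^ tri (3 * r) + q ^ tri (3 * r + 2)) + q * q ^ (9 * tri r))"
    unfolding tri_3_1 by (simp only: power_add power_one_right ac_simps)
  also have "\<dots> = fps_suminf (\<lambda>r. q ^ tri (3 * r) + q ^ tri (3 * r + 2)) + fps_suminf (\<lambda>r. q * q ^ (9 * tri r))"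
    by (rule fps_suminf_add)
  also have "fps_suminf (\<lambda>r. q * q ^ (9 * tri r)) = q * fps_suminf (\<lambda>r. q ^ (9 * tri r))"
    by (intro fps_suminf_mult ascending_X_power tri_ge_mult) simp
  also have "fps_suminf (\<lambda>r. q ^ (9 * tri r)) = psi oo q ^ 9"
    unfolding psi_def by (subst fps_suminf_compose_X_power[OF ascending_tri])
      (simp_all add: X_power_compose_X_power)
  also have "fps_suminf (\<lambda>r. q ^ tri (3 * r) + q ^ tri (3 * r + 2)) = E oo q ^ 3"
  proof -
    have asc: "ascending (\<lambda>r. q ^ (pent r + r) * (1 + q ^ (2 * r + 1)))"
      by (intro ascending_X_power_mult) auto
    have "(q ^ (pent r + r) * (1 + q ^ (2 * r + 1))) oo q ^ 3 = q ^ tri (3 * r) + q ^ tri (3 * r + 2)" for r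
      unfolding tri_3 tri_3_2 distrib_left[of 3 "pent r + r"] power_add[of q "3 * (pent r + r)"]
      by (simp add: fps_compose_mult_distrib fps_compose_add_distrib X_power_compose_X_power distrib_left
          del: power_Suc)
    thus ?thesis
      by (subst E_pentagonal, subst fps_suminf_compose_X_power[OF asc]) simp_all
  qed
  finally show ?thesis .
qed

section \<open>The relation between \<open>E\<close> and \<open>E3\<close>\<close>

definition E3 :: "bit fps" where "E3 = E oo q ^ 3"

lemma E3_nth_0 [simp]: "fps_nth E3 0 = 1"
  by (simp add: E3_def)

lemma E3_inverse [simp]: "E3 * inverse E3 = 1" "inverse E3 * E3 = 1"
  by (simp_all add: inverse_mult_eq_1 inverse_mult_eq_1')

lemma E_cubed_dissection: "E ^ 3 = E3 + q * (E3 oo q ^ 3) ^ 3"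
proof -
  have "psi oo q ^ 9 = (E oo q ^ 9) ^ 3"
    by (simp add: fps_compose_power flip: E_cubed)
  also have "E oo q ^ 9 = E3 oo q ^ 3"
    unfolding E3_def by (simp add: fps_compose_assoc[symmetric] fps_X_power_compose flip: power_mult)
  finally show ?thesis
    using psi_dissection by (simp add: E_cubed E3_def)
qed

text \<open>
  Substituting the 3-dissection of the cube of \<open>E\<close> shows that the difference \<open>D\<close> of both sides
  satisfies \<open>D(q) = q D(q\<^sup>3)\<close>, which forces \<open>D = 0\<close>.
\<close>

lemma E_E3_identity: "E ^ 3 * E3 ^ 3 = E ^ 12 + q * E3 ^ 12"
proof -
  define D where "D = E ^ 3 * E3 ^ 3 + E ^ 12 + q * E3 ^ 12"
  define w where "w = E3 oo q ^ 3"
  have E3': "E ^ 3 = E3 + q * w ^ 3"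
    unfolding w_def by (rule E_cubed_dissection)
  have "E ^ 12 = ((E ^ 3)\<^sup>2)\<^sup>2"
    by (simp flip: power_mult)
  also have "\<dots> = E3 ^ 4 + q ^ 4 * w ^ 12"
    unfolding E3' by (simp add: bit_fps_square_add power_mult_distrib flip: power_mult)
  finally have E12: "E ^ 12 = E3 ^ 4 + q ^ 4 * w ^ 12" .
  have "D oo q ^ 3 = E3 ^ 3 * w ^ 3 + E3 ^ 12 + q ^ 3 * w ^ 12"
    unfolding D_def w_def
    by (simp add: fps_compose_add_distrib fps_compose_mult_distrib fps_compose_power[symmetric] fps_X_power_compose
        flip: E3_def)
  hence "q * (D oo q ^ 3) = q * w ^ 3 * E3 ^ 3 + q ^ 4 * w ^ 12 + q * E3 ^ 12"
    by (simp add: algebra_simps numeral_eq_Suc)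
  also have "\<dots> = D"
    unfolding D_def E12 unfolding E3' by (simp add: algebra_simps numeral_eq_Suc)
  finally have D: "D = q * (D oo q ^ 3)" by simp
  \<comment> \<open>By the functional equation coefficient 0 vanishes, and any other is 0 or the
    coefficient with index \<open>(n - 1) div 3 < n\<close>.\<close>
  have "fps_nth D n = 0" for n
  proof (induction n rule: less_induct)
    case (less n)
    have "fps_nth D n = (if n = 0 then 0 else fps_nth (D oo q ^ 3) (n - 1))"
      by (subst D) simp
    also have "\<dots> = 0"
      using less by (auto simp: fps_nth_compose_X_power)
    finally show ?case .
  qed
  hence "D = 0" by (simp add: fps_eq_iff)
  thus ?thesis unfolding D_def by (simp add: add.assoc bit_fps_add_eq_0_iff)
qed

subsection \<open>The mock theta functions modulo 2\<close>

text \<open>Euler's count of partitions by largest part: consecutive \<open>iQ\<close> differ by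
  exactly the next term.\<close>

lemma sum_X_power_iQ: "(\<Sum>m\<le>N. q ^ m * iQ m) = iQ N"
proof (induction N)
  case (Suc N)
  have "(\<Sum>m\<le>Suc N. q ^ m * iQ m) = iQ N + q ^ Suc N * iQ (Suc N)"
    by (simp add: Suc)
  also have "\<dots> = iQ (Suc N)"
    by (simp add: iQ_eq_Suc[of N] algebra_simps)
  finally show ?case .
qed auto

lemma fps_suminf_iQ: "fps_suminf (\<lambda>m. q ^ m * iQ m) = inverse E"
  by (rule fps_suminf_eqI) (simp add: sum_X_power_iQ iQ_agree)

text \<open>In \<open>durfee_sum\<close> the left side tends to \<open>1 / E^2\<close> and the
  factor \<open>iQ (n - k)\<close> to \<open>1 / E\<close>.\<close>

lemma fps_suminf_durfee: "fps_suminf (\<lambda>k. q ^ (k ^ 2) * (iQ k)\<^sup>2) = inverse E"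
proof -
  have "(inverse E) ^ 2 = inverse E * fps_suminf (\<lambda>k. q ^ (k ^ 2) * (iQ k)\<^sup>2)"
  proof (rule fps_eqI_agree)
    fix N
    have "fps_agree N ((inverse E) ^ 2) ((iQ (2 * N))\<^sup>2)"
      by (intro fps_agree_power fps_agree_sym[OF iQ_agree]) auto
    also have "(iQ (2 * N))\<^sup>2 = (\<Sum>k\<le>2 * N. q ^ (k ^ 2) * ((iQ k)\<^sup>2 * iQ (2 * N - k)))"
      by (subst durfee_sum) (simp only: mult.assoc)
    also have "fps_agree N \<dots> (inverse E * fps_suminf (\<lambda>k. q ^ (k ^ 2) * (iQ k)\<^sup>2))"
      by (intro bailey_limit iQ_agree) (auto simp: power2_eq_square)
    finally show "fps_agree N ((inverse E) ^ 2) (inverse E * fps_suminf (\<lambda>k. q ^ (k ^ 2) * (iQ k)\<^sup>2))" .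
  qed
  hence "E * (inverse E) ^ 2 = E * (inverse E * fps_suminf (\<lambda>k. q ^ (k ^ 2) * (iQ k)\<^sup>2))"
    by (rule arg_cong)
  thus ?thesis by (simp add: power2_eq_square flip: mult.assoc)
qed

text \<open>The summand is the difference of consecutive values of \<open>R n * iQ n\<close>, which
  tends to \<open>1 / E^2\<close>; the added 1 cancels the initial value.\<close>

lemma fps_suminf_mu:
  "1 + fps_suminf (\<lambda>n. q ^ (n + 1) * (1 + q ^ n) * R n * iQ (n + 1)) = (inverse E)\<^sup>2"
proof -
  have "fps_suminf (\<lambda>n. q ^ (n + 1) * (1 + q ^ n) * R n * iQ (n + 1)) = (inverse E)\<^sup>2 + 1"
  proof (rule fps_suminf_eqI)
    fix N
    have "(\<Sum>n\<le>M. q ^ (n + 1) * (1 + q ^ n) * R n * iQ (n + 1)) = R (Suc M) * iQ (Suc M) + 1" for M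
    proof (induction M)
      case 0
      show ?case using Q_iQ[of "Suc 0"] by (simp add: Q_Suc R_Suc)
    next
      case (Suc M)
      thus ?case by (simp add: R_Suc iQ_eq_Suc[of "Suc M"] algebra_simps)
    qed
    moreover have "fps_agree N (R (Suc N) * iQ (Suc N)) ((inverse E)\<^sup>2)"
      unfolding power2_eq_square by (intro fps_agree_mult R_agree iQ_agree) auto
    ultimately show "fps_agree N (\<Sum>n\<le>N. q ^ (n + 1) * (1 + q ^ n) * R n * iQ (n + 1)) ((inverse E)\<^sup>2 + 1)"
      by (simp add: fps_agree_def)
  qed
  thus ?thesis by (simp add: add.commute)
qed

text \<open>
  The sums over \<open>n\<close> of the following terms are \<open>q\<close>-Gauss sums. A telescoping relation shows that
  \<open>q\<^bsup>-r\<^esup> (1 + q\<^bsup>2r+1\<^esup>)\<close> times the \<open>r\<close>-th sum does not depend on \<open>r\<close>; letting \<open>r\<close> tend to infinity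
  evaluates it.
\<close>

definition gauss_term :: "nat \<Rightarrow> nat \<Rightarrow> bit fps" where
  "gauss_term r n = (if r \<le> n then q ^ n * (R n * iQ (n - r) * iQ (n + r + 1)) else 0)"

lemma ascending_gauss_term: "ascending (gauss_term r)"
  unfolding gauss_term_def by (intro ascending_if ascending_X_power_mult) auto

lemma gauss_sum_step:
  "(1 + q ^ (2 * r + 3)) * fps_suminf (gauss_term (Suc r)) = q * (1 + q ^ (2 * r + 1)) * fps_suminf (gauss_term r)"
proof -
  \<comment> \<open>Telescoping certificate for the recurrence in \<open>r\<close>. Its cutoff makes
    \<open>n = r\<close> a boundary case, to which only \<open>gauss_term r\<close> and
    \<open>H (Suc n)\<close> contribute.\<close>
  define H where "H = (\<lambda>n. if Suc r \<le> n then q ^ n * ((1 + q ^ (2 * r + 2)) * R n * iQ (n - Suc r) * iQ (n + r + 1)) else 0)"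
  have step: "(1 + q ^ (2 * r + 3)) * gauss_term (Suc r) n + q * (1 + q ^ (2 * r + 1)) * gauss_term r n = H (Suc n) - H n" for n
  proof -
    consider "n < r" | "n = r" | m where "n = m + Suc r"
      by (metis add.commute le_Suc_ex not_less_eq_eq nat_less_le not_le)
    thus ?thesis
    proof cases
      case 1
      thus ?thesis by (simp add: gauss_term_def H_def)
    next
      case 2
      thus ?thesis
        by (simp add: gauss_term_def H_def R_Suc iQ_eq_Suc[of "Suc (r + r)"] power_expand mult_ac)
    next
      case 3
      define a b where "a = q ^ m" and "b = q ^ r"
      define J where "J = R (m + Suc r) * iQ (Suc m) * iQ (Suc (Suc (Suc (m + r + r))))"
      have 1: "gauss_term (Suc r) n = q * a * b * (1 + q * a) * J"
        unfolding gauss_term_def J_def a_def b_def 3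
        by (simp add: iQ_eq_Suc[of m] power_expand mult_ac)
      have 2: "gauss_term r n = q * a * b * (1 + q * q * q * a * b * b) * J"
        unfolding gauss_term_def J_def a_def b_def 3
        by (simp add: iQ_eq_Suc[of "Suc (Suc (m + r + r))"] Suc_diff_le power_expand mult_ac)
      have 3: "H n = q * a * b * (1 + q * q * b * b) * (1 + q * a) * (1 + q * q * q * a * b * b) * J"
        unfolding H_def J_def a_def b_def 3
        by (simp add: iQ_eq_Suc[of m] iQ_eq_Suc[of "Suc (Suc (m + r + r))"] power_expand mult_ac)
      have 4: "H (Suc n) = q * q * a * b * (1 + q * q * b * b) * (1 + q * q * q * a * b * a * b) * J"
        unfolding H_def J_def a_def b_def \<open>n = m + Suc r\<close>
        by (simp add: R_Suc[of "Suc (m + r)"] Suc_diff_le power_expand mult_ac)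
      have 5: "q ^ (2 * r + 3) = q * q * q * b * b" "q ^ (2 * r + 1) = q * b * b"
        unfolding b_def by (simp_all add: power_expand power3_eq_cube mult_ac)
      show ?thesis
        unfolding 1 2 3 4 5 by (simp add: algebra_simps)
    qed
  qed
  have H: "ascending H"
    unfolding H_def by (intro ascending_if ascending_X_power_mult) auto
  have "(1 + q ^ (2 * r + 3)) * fps_suminf (gauss_term (Suc r)) + q * (1 + q ^ (2 * r + 1)) * fps_suminf (gauss_term r)
      = fps_suminf (\<lambda>n. H (Suc n) - H n)"
    unfolding step[symmetric] by (simp only: fps_suminf_add fps_suminf_mult[OF ascending_gauss_term])
  also have "\<dots> = - H 0"
    by (rule fps_suminf_telescope[OF H])
  also have "\<dots> = 0"
    by (simp add: H_def)
  finally show ?thesis by (simp add: bit_fps_add_eq_0_iff)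
qed

lemma gauss_sum: "(1 + q ^ (2 * r + 1)) * fps_suminf (gauss_term r) = q ^ r * (inverse E) ^ 3"
proof -
  define U where "U = (1 + q) * fps_suminf (gauss_term 0)"
  have U: "(1 + q ^ (2 * r + 1)) * fps_suminf (gauss_term r) = q ^ r * U" for r
  proof (induction r)
    case 0
    show ?case by (simp add: U_def)
  next
    case (Suc r)
    thus ?case using gauss_sum_step[of r] by (simp add: numeral_3_eq_3 mult.assoc)
  qed
  have "U = (inverse E) ^ 3"
  proof (rule fps_eqI_agree)
    fix N
    \<comment> \<open>The sum for \<open>r = N\<close> with its leading factor \<open>q ^ N\<close>
      removed. Up to order \<open>N\<close> the factors of index at least \<open>N\<close> may be
      replaced by \<open>1 / E\<close>, and \<open>fps_suminf_iQ\<close> supplies the third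
      \<open>1 / E\<close>.\<close>
    define V where "V = fps_suminf (\<lambda>m. q ^ m * (R (m + N) * iQ m * iQ (m + N + N + 1)))"
    have "fps_suminf (gauss_term N) = q ^ N * V"
      unfolding V_def
    proof (rule fps_suminf_shift[where r = N])
      show "ascending (\<lambda>m. q ^ m * (R (m + N) * iQ m * iQ (m + N + N + 1)))"
        by (intro ascending_X_power_mult) auto
    qed (auto simp: gauss_term_def power_add mult_ac)
    hence "q ^ N * U = q ^ N * ((1 + q ^ (2 * N + 1)) * V)"
      using U[of N] by (simp only: mult_ac)
    hence "U = (1 + q ^ (2 * N + 1)) * V"
      by simp
    also have "\<dots> = V + q ^ (2 * N + 1) * V"
      by (simp only: distrib_right mult_1_left)
    also have "fps_agree N \<dots> V"
      by (intro fps_agree_X_power_mult) auto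
    also have "fps_agree N V (fps_suminf (\<lambda>m. q ^ m * (inverse E * iQ m * inverse E)))"
      unfolding V_def by (intro fps_suminf_agree_cong fps_agree_mult fps_agree_refl R_agree iQ_agree) auto
    also have "fps_suminf (\<lambda>m. q ^ m * (inverse E * iQ m * inverse E)) =
        fps_suminf (\<lambda>m. (inverse E * inverse E) * (q ^ m * iQ m))"
      by (simp only: ac_simps)
    also have "\<dots> = (inverse E) ^ 3"
      by (subst fps_suminf_mult[OF ascending_X_power_mult]) (simp_all add: fps_suminf_iQ power3_eq_cube)
    finally show "fps_agree N U ((inverse E) ^ 3)" .
  qed
  thus ?thesis using U by simp
qed

text \<open>Insert \<open>bailey_pentagonal\<close> for \<open>iQ n\<close> and exchange the sums:
  by \<open>gauss_sum\<close> the inner sum for \<open>r\<close> is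
  \<open>q ^ (3 * tri r) / E^3\<close>, and the outer sum is \<open>psi\<close> at
  \<open>q^3\<close>.\<close>

lemma fps_suminf_lambda: "fps_suminf (\<lambda>n. q ^ n * R n * iQ n) = E3 ^ 3 * (inverse E) ^ 3"
proof -
  define c where "c = (\<lambda>r. q ^ (pent r + r) * (1 + q ^ (2 * r + 1)))"
  have "q ^ n * R n * iQ n = (\<Sum>r\<le>n. q ^ n * (c r * (R n * iQ (n - r) * iQ (n + r + 1))))" for n
    unfolding c_def by (subst bailey_pentagonal) (simp only: sum_distrib_left ac_simps)
  hence "fps_suminf (\<lambda>n. q ^ n * R n * iQ n) =
      fps_suminf (\<lambda>n. \<Sum>r\<le>n. q ^ n * (c r * (R n * iQ (n - r) * iQ (n + r + 1))))"
    by simp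
  also have "\<dots> = fps_suminf (\<lambda>r. fps_suminf (\<lambda>n. if r \<le> n then q ^ n * (c r * (R n * iQ (n - r) * iQ (n + r + 1))) else 0))"
    by (rule fps_suminf_swap)
  also have "(\<lambda>r. fps_suminf (\<lambda>n. if r \<le> n then q ^ n * (c r * (R n * iQ (n - r) * iQ (n + r + 1))) else 0)) =
      (\<lambda>r. (inverse E) ^ 3 * q ^ (3 * tri r))"
  proof
    fix r
    have "fps_suminf (\<lambda>n. if r \<le> n then q ^ n * (c r * (R n * iQ (n - r) * iQ (n + r + 1))) else 0) =
        fps_suminf (\<lambda>n. c r * gauss_term r n)"
      by (rule arg_cong[where f = fps_suminf]) (auto simp: gauss_term_def fun_eq_iff mult_ac)
    also have "\<dots> = q ^ (pent r + r) * ((1 + q ^ (2 * r + 1)) * fps_suminf (gauss_term r))"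
      unfolding fps_suminf_mult[OF ascending_gauss_term] c_def by (rule mult.assoc)
    also have "\<dots> = (inverse E) ^ 3 * q ^ (pent r + r + r)"
      unfolding gauss_sum by (simp only: power_add mult_ac)
    finally show "fps_suminf (\<lambda>n. if r \<le> n then q ^ n * (c r * (R n * iQ (n - r) * iQ (n + r + 1))) else 0) =
        (inverse E) ^ 3 * q ^ (3 * tri r)"
      by (simp only: pent_tri)
  qed
  also have "fps_suminf (\<lambda>r. (inverse E) ^ 3 * q ^ (3 * tri r)) = (inverse E) ^ 3 * fps_suminf (\<lambda>r. q ^ (3 * tri r))"
    by (intro fps_suminf_mult ascending_X_power tri_ge_mult) simp
  also have "fps_suminf (\<lambda>r. q ^ (3 * tri r)) = psi oo q ^ 3"
    unfolding psi_def by (subst fps_suminf_compose_X_power[OF ascending_tri])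
      (simp_all add: X_power_compose_X_power)
  also have "\<dots> = E3 ^ 3"
    by (simp add: fps_compose_power E3_def flip: E_cubed)
  finally show ?thesis by (simp add: mult.commute)
qed

text \<open>The limiting case of the \<open>q\<close>-Gauss sum in base \<open>q\<^sup>2\<close>, evaluated in the same way.\<close>

definition gauss_term' :: "nat \<Rightarrow> nat \<Rightarrow> bit fps" where
  "gauss_term' r n = (if r \<le> n then q ^ (n * n + 2 * n) * (R n * (iQ (n - r))\<^sup>2 * (iQ (n + r + 1))\<^sup>2) else 0)"

lemma ascending_gauss_term': "ascending (gauss_term' r)"
  unfolding gauss_term'_def by (intro ascending_if ascending_X_power_mult) auto

lemma gauss_sum_step':
  "(1 + q ^ (2 * r + 3)) * fps_suminf (gauss_term' (Suc r)) =
   q ^ (2 * r + 3) * (1 + q ^ (2 * r + 1)) * fps_suminf (gauss_term' r)"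
proof -
  define H where "H = (\<lambda>n. if Suc r \<le> n then q ^ (n * n + 2 * n) *
      ((1 + q ^ (4 * r + 4)) * R n * (iQ (n - Suc r))\<^sup>2 * (iQ (n + r + 1))\<^sup>2) else 0)"
  have step: "(1 + q ^ (2 * r + 3)) * gauss_term' (Suc r) n + q ^ (2 * r + 3) * (1 + q ^ (2 * r + 1)) * gauss_term' r n = H (Suc n) - H n" for n
  proof -
    define b where "b = q ^ r"
    have 5: "q ^ (2 * r + 3) = q * q * q * b * b" "q ^ (2 * r + 1) = q * b * b" "q ^ (4 * r + 4) = q * q * q * q * b * b * b * b"
      unfolding b_def by (simp_all add: power_expand numeral_eq_Suc mult_ac)
    consider "n < r" | "n = r" | m where "n = m + Suc r"
      by (metis add.commute le_Suc_ex not_less_eq_eq nat_less_le not_le)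
    thus ?thesis
    proof cases
      case 1
      thus ?thesis by (simp add: gauss_term'_def H_def)
    next
      case 2
      define e where "e = q ^ (r * r)"
      have *: "q ^ (r * r + 2 * r) = e * b * b" "q ^ (Suc r * Suc r + 2 * Suc r) = e * q * q * q * b * b * b * b"
        unfolding e_def b_def by (simp_all add: power_expand mult_ac)
      show ?thesis
        unfolding gauss_term'_def H_def 5 2 *
        by (simp add: R_Suc iQ_eq_Suc[of "Suc (r + r)"] power_expand power2_eq_square flip: b_def)
          (simp add: algebra_simps)
    next
      case 3
      define a where "a = q ^ m"
      define e where "e = q ^ (n * n)"
      define J where "J = R (m + Suc r) * (iQ (Suc m))\<^sup>2 * (iQ (Suc (Suc (Suc (m + r + r)))))\<^sup>2"
      have n: "q ^ n = q * a * b"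
        unfolding 3 a_def b_def by (simp add: power_add mult_ac)
      have *: "q ^ (n * n + 2 * n) = e * (q * a * b) * (q * a * b)"
        "q ^ (Suc n * Suc n + 2 * Suc n) = e * q * q * q * (q * a * b) * (q * a * b) * (q * a * b) * (q * a * b)"
        unfolding n[symmetric] e_def by (simp_all add: power_expand mult_ac)
      have 1: "gauss_term' (Suc r) n = e * (q * a * b) * (q * a * b) * (1 + q * a)\<^sup>2 * J"
        unfolding gauss_term'_def J_def a_def * unfolding 3
        by (simp add: iQ_eq_Suc[of m] power_mult_distrib power_expand mult_ac)
      have 2: "gauss_term' r n = e * (q * a * b) * (q * a * b) * (1 + q * q * q * a * b * b)\<^sup>2 * J"
        unfolding gauss_term'_def J_def a_def b_def * unfolding 3
        by (simp add: iQ_eq_Suc[of "Suc (Suc (m + r + r))"] Suc_diff_le power_expand power_mult_distrib mult_ac)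
      have 4: "H n = e * (q * a * b) * (q * a * b) * (1 + q * q * q * q * b * b * b * b) * (1 + q * a)\<^sup>2 * (1 + q * q * q * a * b * b)\<^sup>2 * J"
        unfolding H_def J_def 5 * a_def b_def unfolding 3
        by (simp add: iQ_eq_Suc[of m] iQ_eq_Suc[of "Suc (Suc (m + r + r))"] power_expand power_mult_distrib mult_ac)
      have 6: "H (Suc n) = e * q * q * q * (q * a * b) * (q * a * b) * (q * a * b) * (q * a * b) * (1 + q * q * q * q * b * b * b * b) * (1 + q * (q * a * b) * (q * a * b)) * J"
        unfolding H_def J_def 5 * n[symmetric] R_Suc unfolding 3
        by (simp add: Suc_diff_le mult_ac)
      show ?thesis
        unfolding 1 2 4 5 6 by (simp add: power2_eq_square algebra_simps)
    qed
  qed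
  have H: "ascending H"
    unfolding H_def by (intro ascending_if ascending_X_power_mult) auto
  have "(1 + q ^ (2 * r + 3)) * fps_suminf (gauss_term' (Suc r)) + q ^ (2 * r + 3) * (1 + q ^ (2 * r + 1)) * fps_suminf (gauss_term' r)
      = fps_suminf (\<lambda>n. H (Suc n) - H n)"
    unfolding step[symmetric] by (simp only: fps_suminf_add fps_suminf_mult[OF ascending_gauss_term'])
  also have "\<dots> = - H 0"
    by (rule fps_suminf_telescope[OF H])
  also have "\<dots> = 0"
    by (simp add: H_def)
  finally show ?thesis by (simp add: bit_fps_add_eq_0_iff)
qed

lemma gauss_sum': "(1 + q ^ (2 * r + 1)) * fps_suminf (gauss_term' r) = q ^ (r * r + 2 * r) * (inverse E) ^ 3"
proof -
  define U where "U = (1 + q) * fps_suminf (gauss_term' 0)"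
  have U: "(1 + q ^ (2 * r + 1)) * fps_suminf (gauss_term' r) = q ^ (r * r + 2 * r) * U" for r
  proof (induction r)
    case 0
    show ?case by (simp add: U_def)
  next
    case (Suc r)
    have "(1 + q ^ (2 * Suc r + 1)) * fps_suminf (gauss_term' (Suc r)) =
        q ^ (2 * r + 3) * ((1 + q ^ (2 * r + 1)) * fps_suminf (gauss_term' r))"
      using gauss_sum_step'[of r] by (simp add: numeral_3_eq_3 mult.assoc)
    also have "\<dots> = q ^ (2 * r + 3 + (r * r + 2 * r)) * U"
      unfolding Suc by (simp only: power_add mult.assoc)
    also have "2 * r + 3 + (r * r + 2 * r) = Suc r * Suc r + 2 * Suc r"
      by simp
    finally show ?case .
  qed
  have "U = (inverse E) ^ 3"
  proof (rule fps_eqI_agree)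
    fix N
    define r where "r = Suc N"
    \<comment> \<open>Once \<open>q ^ (r * r + 2 * r)\<close> is removed, the exponents exceed
      \<open>N\<close> for all \<open>m > 0\<close>. Only \<open>m = 0\<close> survives up to order
      \<open>N\<close>, and its three factors tend to \<open>1 / E\<close> each.\<close>
    define V where "V = fps_suminf (\<lambda>m. q ^ (m * m + 2 * r * m + 2 * m) * (R (m + r) * (iQ m)\<^sup>2 * (iQ (m + r + r + 1))\<^sup>2))"
    have asc: "ascending (\<lambda>m. q ^ (m * m + 2 * r * m + 2 * m) * (R (m + r) * (iQ m)\<^sup>2 * (iQ (m + r + r + 1))\<^sup>2))"
      by (intro ascending_X_power_mult) auto
    have "fps_suminf (gauss_term' r) = q ^ (r * r + 2 * r) * V"
      unfolding V_def
    proof (rule fps_suminf_shift[where r = r, OF asc])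
      fix n
      have "(n + r) * (n + r) + 2 * (n + r) = (r * r + 2 * r) + (n * n + 2 * r * n + 2 * n)"
        by (simp add: algebra_simps)
      thus "gauss_term' r (n + r) = q ^ (r * r + 2 * r) *
          (q ^ (n * n + 2 * r * n + 2 * n) * (R (n + r) * (iQ n)\<^sup>2 * (iQ (n + r + r + 1))\<^sup>2))"
        by (simp only: gauss_term'_def power_add) (simp add: mult.assoc)
    qed (auto simp: gauss_term'_def)
    hence "q ^ (r * r + 2 * r) * U = q ^ (r * r + 2 * r) * ((1 + q ^ (2 * r + 1)) * V)"
      using U[of r] by (simp only: mult_ac)
    hence "U = (1 + q ^ (2 * r + 1)) * V"
      by simp
    also have "\<dots> = V + q ^ (2 * r + 1) * V"
      by (simp only: distrib_right mult_1_left)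
    also have "fps_agree N \<dots> V"
      by (intro fps_agree_X_power_mult) (auto simp: r_def)
    also have "fps_agree N V (\<Sum>m\<le>N. q ^ (m * m + 2 * r * m + 2 * m) * (R (m + r) * (iQ m)\<^sup>2 * (iQ (m + r + r + 1))\<^sup>2))"
      unfolding V_def by (rule fps_suminf_agree[OF asc]) simp
    also have "fps_agree N \<dots> (\<Sum>m\<le>N. if m = 0 then (inverse E) ^ 3 else 0)"
    proof (rule fps_agree_sum)
      fix m
      show "fps_agree N (q ^ (m * m + 2 * r * m + 2 * m) * (R (m + r) * (iQ m)\<^sup>2 * (iQ (m + r + r + 1))\<^sup>2))
          (if m = 0 then (inverse E) ^ 3 else 0)"
      proof (cases "m = 0")
        case True
        have "fps_agree N (R r * (iQ (r + r + 1))\<^sup>2) (inverse E * (inverse E)\<^sup>2)"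
          by (intro fps_agree_mult fps_agree_power R_agree iQ_agree) (auto simp: r_def)
        thus ?thesis using True by (simp add: numeral_eq_Suc)
      next
        case False
        have "N < m * m + 2 * r * m + 2 * m" using False by (cases m) (auto simp: r_def)
        thus ?thesis using False by (simp add: fps_agree_def fps_X_power_mult_nth)
      qed
    qed
    also have "(\<Sum>m\<le>N. if m = 0 then (inverse E) ^ 3 else 0) = (inverse E) ^ 3"
      by simp
    finally show "fps_agree N U ((inverse E) ^ 3)" .
  qed
  thus ?thesis using U by simp
qed

text \<open>As for \<open>lambda_6\<close>, with \<open>bailey_triangular\<close> and
  \<open>gauss_sum'\<close>. The exponents \<open>2 r^2 + r\<close> and \<open>r^2 + 2 r\<close> add
  up to \<open>6 tri r\<close>, and Frobenius turns \<open>psi\<close> at \<open>q^6\<close> into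
  \<open>E3 ^ 6\<close>.\<close>

lemma fps_suminf_psi6:
  "fps_suminf (\<lambda>n. q ^ ((n + 1) ^ 2) * R n * iQ (2 * n + 1)) = q * (E3 ^ 6 * (inverse E) ^ 3)"
proof -
  define c where "c = (\<lambda>r. q ^ (2 * r ^ 2 + r) * (1 + q ^ (2 * r + 1)))"
  have "fps_suminf (\<lambda>n. q ^ ((n + 1) ^ 2) * R n * iQ (2 * n + 1)) =
      fps_suminf (\<lambda>n. q * (q ^ (n * n + 2 * n) * (R n * iQ (2 * n + 1))))"
    by (simp add: power2_eq_square power_expand mult_ac)
  also have "\<dots> = q * fps_suminf (\<lambda>n. q ^ (n * n + 2 * n) * (R n * iQ (2 * n + 1)))"
    by (intro fps_suminf_mult ascending_X_power_mult) auto
  also have "(\<lambda>n. q ^ (n * n + 2 * n) * (R n * iQ (2 * n + 1))) =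
      (\<lambda>n. \<Sum>r\<le>n. q ^ (n * n + 2 * n) * (c r * (R n * (iQ (n - r))\<^sup>2 * (iQ (n + r + 1))\<^sup>2)))"
    unfolding c_def by (subst bailey_triangular) (simp only: sum_distrib_left ac_simps)
  also have "fps_suminf \<dots> = fps_suminf (\<lambda>r. fps_suminf (\<lambda>n. if r \<le> n then q ^ (n * n + 2 * n) * (c r * (R n * (iQ (n - r))\<^sup>2 * (iQ (n + r + 1))\<^sup>2)) else 0))"
    by (rule fps_suminf_swap)
  also have "(\<lambda>r. fps_suminf (\<lambda>n. if r \<le> n then q ^ (n * n + 2 * n) * (c r * (R n * (iQ (n - r))\<^sup>2 * (iQ (n + r + 1))\<^sup>2)) else 0)) =
      (\<lambda>r. (inverse E) ^ 3 * q ^ (2 * (3 * tri r)))"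
  proof
    fix r
    have "fps_suminf (\<lambda>n. if r \<le> n then q ^ (n * n + 2 * n) * (c r * (R n * (iQ (n - r))\<^sup>2 * (iQ (n + r + 1))\<^sup>2)) else 0) =
        fps_suminf (\<lambda>n. c r * gauss_term' r n)"
      by (rule arg_cong[where f = fps_suminf]) (auto simp: gauss_term'_def fun_eq_iff mult_ac)
    also have "\<dots> = q ^ (2 * r ^ 2 + r) * ((1 + q ^ (2 * r + 1)) * fps_suminf (gauss_term' r))"
      unfolding fps_suminf_mult[OF ascending_gauss_term'] c_def by (rule mult.assoc)
    also have "\<dots> = (inverse E) ^ 3 * q ^ (2 * r ^ 2 + r + (r * r + 2 * r))"
      unfolding gauss_sum' by (simp only: power_add mult_ac)
    also have "2 * r ^ 2 + r + (r * r + 2 * r) = 2 * (3 * tri r)"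
      by (induction r) (auto simp: tri_Suc power2_eq_square)
    finally show "fps_suminf (\<lambda>n. if r \<le> n then q ^ (n * n + 2 * n) * (c r * (R n * (iQ (n - r))\<^sup>2 * (iQ (n + r + 1))\<^sup>2)) else 0) =
        (inverse E) ^ 3 * q ^ (2 * (3 * tri r))" .
  qed
  also have "fps_suminf (\<lambda>r. (inverse E) ^ 3 * q ^ (2 * (3 * tri r))) = (inverse E) ^ 3 * fps_suminf (\<lambda>r. q ^ (2 * (3 * tri r)))"
    unfolding mult.assoc[symmetric, of 2 3]
    by (intro fps_suminf_mult ascending_X_power tri_ge_mult) simp
  also have "fps_suminf (\<lambda>r. q ^ (2 * (3 * tri r))) = psi oo q ^ 3 oo q ^ 2"
  proof -
    have asc: "ascending (\<lambda>r. q ^ (3 * tri r))"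
      by (intro ascending_X_power tri_ge_mult) simp
    have "psi oo q ^ 3 = fps_suminf (\<lambda>r. q ^ (3 * tri r))"
      unfolding psi_def by (subst fps_suminf_compose_X_power[OF ascending_tri])
        (simp_all add: X_power_compose_X_power)
    thus ?thesis
      by (simp add: fps_suminf_compose_X_power[OF asc] X_power_compose_X_power)
  qed
  also have "psi oo q ^ 3 = E3 ^ 3"
    by (simp add: fps_compose_power E3_def flip: E_cubed)
  also have "E3 ^ 3 oo q ^ 2 = (E3 ^ 3)\<^sup>2"
    by (rule bit_fps_square[symmetric])
  finally show ?thesis by (simp add: mult.commute flip: power_mult)
qed

subsection \<open>Reduction modulo 2\<close>

text \<open>One integer must serve both as complex coefficient and as residue, so integrality and
  reduction are carried together.\<close>

definition reduces_to :: "complex fps \<Rightarrow> bit fps \<Rightarrow> bool" where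
  "reduces_to F f \<longleftrightarrow> (\<forall>n. \<exists>a::int. fps_nth F n = of_int a \<and> fps_nth f n = of_int a)"

lemma reduces_toD: "reduces_to F f \<Longrightarrow> \<exists>a::int. fps_nth F n = of_int a \<and> fps_nth f n = of_int a"
  by (simp add: reduces_to_def)

lemma reduces_to_0 [intro]: "reduces_to 0 0"
  unfolding reduces_to_def by (metis fps_zero_nth of_int_0)

lemma reduces_to_1 [intro]: "reduces_to 1 1"
  unfolding reduces_to_def by (metis fps_one_nth of_int_0 of_int_1)

lemma reduces_to_X [intro]: "reduces_to fps_X fps_X"
  unfolding reduces_to_def by (metis fps_X_nth of_int_0 of_int_1)

lemma reduces_to_uminus: "reduces_to F f \<Longrightarrow> reduces_to (- F) (- f)"
  unfolding reduces_to_def by (metis fps_neg_nth of_int_minus)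

lemma reduces_to_add: "reduces_to F f \<Longrightarrow> reduces_to G g \<Longrightarrow> reduces_to (F + G) (f + g)"
  unfolding reduces_to_def by (metis fps_add_nth of_int_add)

lemma reduces_to_diff: "reduces_to F f \<Longrightarrow> reduces_to G g \<Longrightarrow> reduces_to (F - G) (f - g)"
  unfolding reduces_to_def by (metis fps_sub_nth of_int_diff)

lemma sum_of_int_witness:
  assumes "\<And>i. i \<in> A \<Longrightarrow> \<exists>a::int. (x i :: complex) = of_int a \<and> (y i :: bit) = of_int a"
  shows "\<exists>a::int. sum x A = of_int a \<and> sum y A = of_int a"
proof -
  obtain a :: "'a \<Rightarrow> int" where "\<And>i. i \<in> A \<Longrightarrow> x i = of_int (a i) \<and> y i = of_int (a i)"
    using assms by metis
  hence "sum x A = of_int (sum a A)" "sum y A = of_int (sum a A)"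
    by (simp_all add: of_int_sum)
  thus ?thesis by blast
qed

lemma reduces_to_mult:
  assumes "reduces_to F f" "reduces_to G g"
  shows "reduces_to (F * G) (f * g)"
  unfolding reduces_to_def fps_mult_nth
proof (intro allI sum_of_int_witness)
  fix n i :: nat
  obtain a b :: int where "fps_nth F i = of_int a" "fps_nth f i = of_int a"
    "fps_nth G (n - i) = of_int b" "fps_nth g (n - i) = of_int b"
    using assms by (meson reduces_toD)
  hence "fps_nth F i * fps_nth G (n - i) = of_int (a * b)" "fps_nth f i * fps_nth g (n - i) = of_int (a * b)"
    by simp_all
  thus "\<exists>a::int. fps_nth F i * fps_nth G (n - i) = of_int a \<and> fps_nth f i * fps_nth g (n - i) = of_int a"
    by blast
qed

lemma reduces_to_power: "reduces_to F f \<Longrightarrow> reduces_to (F ^ k) (f ^ k)"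
  by (induction k) (auto intro: reduces_to_mult)

lemma reduces_to_qpoch:
  assumes "reduces_to A a" "reduces_to B b"
  shows "reduces_to (qpoch A B n) (qpoch a b n)"
  by (induction n)
    (auto simp: qpoch_Suc simp del: bit_fps_diff intro!: reduces_to_mult reduces_to_diff reduces_to_power assms)

lemma fps_inverse_nth_recurrence:
  fixes f :: "'a::field fps"
  assumes "fps_nth f 0 = 1" "n > 0"
  shows "fps_nth (inverse f) n = - (\<Sum>i<n. fps_nth (inverse f) i * fps_nth f (n - i))"
proof -
  have "inverse f * f = 1"
    using assms by (simp add: inverse_mult_eq_1)
  hence "0 = (\<Sum>i=0..n. fps_nth (inverse f) i * fps_nth f (n - i))"
    using assms(2) by (simp flip: fps_mult_nth)
  also have "\<dots> = (\<Sum>i<n. fps_nth (inverse f) i * fps_nth f (n - i)) + fps_nth (inverse f) n"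
    using assms(1) by (simp add: atLeast0AtMost flip: lessThan_Suc_atMost)
  finally show ?thesis by (simp add: eq_neg_iff_add_eq_0 add.commute)
qed

text \<open>Constant coefficient 1 lets the recurrence for the inverse run over the integers, in
  parallel on both sides.\<close>

lemma reduces_to_inverse:
  assumes "reduces_to F f" "fps_nth F 0 = 1"
  shows "reduces_to (inverse F) (inverse f)"
proof -
  have f0: "fps_nth f 0 = 1"
    using reduces_toD[OF assms(1), of 0] assms(2) by (metis of_int_1 of_int_eq_iff)
  have "\<exists>a::int. fps_nth (inverse F) n = of_int a \<and> fps_nth (inverse f) n = of_int a" for n
  proof (induction n rule: less_induct)
    case (less n)
    show ?case
    proof (cases "n = 0")
      case True
      thus ?thesis using assms(2) f0 by (intro exI[of _ 1]) simp
    next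
      case False
      have "\<exists>a::int. (\<Sum>i<n. fps_nth (inverse F) i * fps_nth F (n - i)) = of_int a \<and>
          (\<Sum>i<n. fps_nth (inverse f) i * fps_nth f (n - i)) = of_int a"
      proof (rule sum_of_int_witness)
        fix i assume "i \<in> {..<n}"
        then obtain a b :: int where "fps_nth (inverse F) i = of_int a" "fps_nth (inverse f) i = of_int a"
          "fps_nth F (n - i) = of_int b" "fps_nth f (n - i) = of_int b"
          using less reduces_toD[OF assms(1)] by (meson lessThan_iff)
        hence "fps_nth (inverse F) i * fps_nth F (n - i) = of_int (a * b)"
          "fps_nth (inverse f) i * fps_nth f (n - i) = of_int (a * b)"
          by simp_all
        thus "\<exists>a::int. fps_nth (inverse F) i * fps_nth F (n - i) = of_int a \<and>
            fps_nth (inverse f) i * fps_nth f (n - i) = of_int a"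
          by blast
      qed
      then obtain a :: int where "(\<Sum>i<n. fps_nth (inverse F) i * fps_nth F (n - i)) = of_int a"
          "(\<Sum>i<n. fps_nth (inverse f) i * fps_nth f (n - i)) = of_int a"
        by blast
      hence "fps_nth (inverse F) n = of_int (- a)" "fps_nth (inverse f) n = of_int (- a)"
        using False assms(2) f0 by (simp_all add: fps_inverse_nth_recurrence)
      thus ?thesis by blast
    qed
  qed
  thus ?thesis by (simp add: reduces_to_def)
qed

lemma reduces_to_divide:
  assumes "reduces_to F f" "reduces_to G g" "fps_nth G 0 = 1"
  shows "reduces_to (F / G) (f * inverse g)"
  using assms by (auto simp: fps_divide_unit intro: reduces_to_mult reduces_to_inverse)

lemma reduces_to_compose_X_power:
  assumes "reduces_to F f" "k > 0"
  shows "reduces_to (F oo fps_X ^ k) (f oo fps_X ^ k)"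
  unfolding reduces_to_def fps_nth_compose_X_power[OF assms(2)]
  by (metis reduces_toD[OF assms(1)] of_int_0)

lemma reduces_to_fps_suminf:
  assumes "\<And>n. reduces_to (F n) (f n)"
  shows "reduces_to (fps_suminf F) (fps_suminf f)"
  unfolding reduces_to_def fps_suminf_def fps_nth_Abs_fps fps_sum_nth
  using assms by (intro allI sum_of_int_witness reduces_toD)

lemma reduces_to_suminf:
  assumes "ascending F" "\<And>n. reduces_to (F n) (f n)"
  shows "reduces_to (suminf F) (fps_suminf f)"
  unfolding suminf_fps[OF assms(1)] by (rule reduces_to_fps_suminf[OF assms(2)])

lemma of_int_bit_eq_iff: "(of_int a :: bit) = of_int b \<longleftrightarrow> [a = b] (mod 2)"
proof -
  have *: "(of_int c :: bit) = (if even c then 0 else 1)" for c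
    by (cases "even c") (auto elim!: evenE oddE)
  show ?thesis
    by (auto simp: * cong_def) presburger+
qed

lemma ccong_iff_bit:
  assumes "reduces_to F f" "reduces_to G g"
  shows "[fps_nth F n \<equiv> fps_nth G m] (mod 2) \<longleftrightarrow> fps_nth f n = fps_nth g m"
proof -
  obtain a b :: int where ab: "fps_nth F n = of_int a" "fps_nth f n = of_int a"
    "fps_nth G m = of_int b" "fps_nth g m = of_int b"
    using assms by (meson reduces_toD)
  thus ?thesis by (auto simp: ccong_def of_int_bit_eq_iff)
qed

section \<open>Reductions of the individual mock theta functions\<close>

lemma qpoch_nth_0: "fps_nth a 0 = 0 \<Longrightarrow> fps_nth (qpoch a b n) 0 = 1"
  by (induction n) (simp_all add: qpoch_Suc)

lemmas reduces_to_intros = reduces_to_mult reduces_to_power reduces_to_qpoch reduces_to_uminus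
  reduces_to_add reduces_to_1 reduces_to_X reduces_to_divide

lemma reduces_to_f_3: "reduces_to f_3 (inverse E)"
proof -
  have "reduces_to f_3 (fps_suminf (\<lambda>n. q ^ (n ^ 2) * inverse ((qpoch (- q) q n) ^ 2)))"
    unfolding f_3_def
  proof (rule reduces_to_suminf)
    show "ascending (\<lambda>n. fps_X ^ n\<^sup>2 / (qpoch (- fps_X) fps_X n)\<^sup>2 :: complex fps)"
      using ascending_X_power_mult[of "\<lambda>n. n\<^sup>2" "\<lambda>n. inverse ((qpoch (- fps_X) fps_X n)\<^sup>2) :: complex fps"]
      by (simp add: fps_divide_unit qpoch_nth_0 power2_nat_le_imp_le power2_eq_square)
  qed (intro reduces_to_intros; simp add: qpoch_nth_0 fps_power_zeroth)
  thus ?thesis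
    by (simp add: fps_suminf_durfee fps_inverse_power flip: Q_def iQ_def)
qed

lemma reduces_to_phi_3: "reduces_to phi_3 (inverse E)"
proof -
  have "reduces_to phi_3 (fps_suminf (\<lambda>n. q ^ (n ^ 2) * inverse (qpoch (- (q\<^sup>2)) (q\<^sup>2) n)))"
    unfolding phi_3_def
  proof (rule reduces_to_suminf)
    show "ascending (\<lambda>n. fps_X ^ n\<^sup>2 / qpoch (- (fps_X\<^sup>2)) (fps_X\<^sup>2) n :: complex fps)"
      using ascending_X_power_mult[of "\<lambda>n. n\<^sup>2" "\<lambda>n. inverse (qpoch (- (fps_X\<^sup>2)) (fps_X\<^sup>2) n) :: complex fps"]
      by (simp add: fps_divide_unit qpoch_nth_0 power2_eq_square)
  qed (intro reduces_to_intros; simp add: qpoch_nth_0)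
  thus ?thesis
    by (simp add: fps_suminf_durfee qpoch_X2 fps_inverse_power flip: iQ_def)
qed

lemma reduces_to_phi_6: "reduces_to phi_6 (inverse E)"
proof -
  have "reduces_to phi_6 (fps_suminf (\<lambda>n. ((- 1) ^ n * qpoch q (q\<^sup>2) n * q ^ (n ^ 2)) * inverse (qpoch (- q) q (2 * n))))"
    unfolding phi_6_def
  proof (rule reduces_to_suminf)
    show "ascending (\<lambda>n. ((- 1) ^ n * qpoch fps_X (fps_X\<^sup>2) n * fps_X ^ n\<^sup>2) / qpoch (- fps_X) fps_X (2 * n) :: complex fps)"
      using ascending_X_power_mult[of "\<lambda>n. n\<^sup>2" "\<lambda>n. (- 1) ^ n * qpoch fps_X (fps_X\<^sup>2) n * inverse (qpoch (- fps_X) fps_X (2 * n)) :: complex fps"]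
      by (simp add: fps_divide_unit qpoch_nth_0 power2_eq_square mult_ac)
  qed (intro reduces_to_intros; simp add: qpoch_nth_0)
  also have "(\<lambda>n. ((- 1) ^ n * qpoch q (q\<^sup>2) n * q ^ (n ^ 2)) * inverse (qpoch (- q) q (2 * n))) =
      (\<lambda>n. q ^ (n ^ 2) * (iQ n)\<^sup>2)"
  proof
    fix n
    \<comment> \<open>Inserting \<open>(Q n * iQ n)^2 = 1\<close> completes \<open>R n\<close> to
      \<open>Q (2 * n)\<close>, which then cancels.\<close>
    have "R n * iQ (2 * n) = (Q n * iQ n)\<^sup>2 * (R n * iQ (2 * n))"
      by simp
    also have "\<dots> = Q (2 * n) * iQ (2 * n) * (iQ n)\<^sup>2"
      unfolding Q_even by (simp only: power_mult_distrib ac_simps)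
    finally have "R n * iQ (2 * n) = (iQ n)\<^sup>2"
      by simp
    thus "((- 1) ^ n * qpoch q (q\<^sup>2) n * q ^ (n ^ 2)) * inverse (qpoch (- q) q (2 * n)) = q ^ (n ^ 2) * (iQ n)\<^sup>2"
      by (simp add: mult_ac flip: Q_def R_def iQ_def)
  qed
  finally show ?thesis by (simp add: fps_suminf_durfee)
qed

lemma reduces_to_psi_6: "reduces_to psi_6 (q * (E3 ^ 6 * (inverse E) ^ 3))"
proof -
  have "reduces_to psi_6 (fps_suminf (\<lambda>n. ((- 1) ^ n * q ^ ((n + 1) ^ 2) * qpoch q (q\<^sup>2) n) * inverse (qpoch (- q) q (2 * n + 1))))"
    unfolding psi_6_def
  proof (rule reduces_to_suminf)
    show "ascending (\<lambda>n. ((- 1) ^ n * fps_X ^ ((n + 1)\<^sup>2) * qpoch fps_X (fps_X\<^sup>2) n) / qpoch (- fps_X) fps_X (2 * n + 1) :: complex fps)"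
      using ascending_X_power_mult[of "\<lambda>n. (n + 1)\<^sup>2" "\<lambda>n. (- 1) ^ n * qpoch fps_X (fps_X\<^sup>2) n * inverse (qpoch (- fps_X) fps_X (2 * n + 1)) :: complex fps"]
      by (simp add: fps_divide_unit qpoch_nth_0 power2_eq_square mult_ac)
  qed (intro reduces_to_intros; simp add: qpoch_nth_0)
  thus ?thesis
    using fps_suminf_psi6 by (simp flip: Q_def R_def iQ_def)
qed

lemma reduces_to_lambda_6: "reduces_to lambda_6 (E3 ^ 3 * (inverse E) ^ 3)"
proof -
  have "reduces_to lambda_6 (fps_suminf (\<lambda>n. ((- 1) ^ n * q ^ n * qpoch q (q\<^sup>2) n) * inverse (qpoch (- q) q n)))"
    unfolding lambda_6_def
  proof (rule reduces_to_suminf)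
    show "ascending (\<lambda>n. ((- 1) ^ n * fps_X ^ n * qpoch fps_X (fps_X\<^sup>2) n) / qpoch (- fps_X) fps_X n :: complex fps)"
      using ascending_X_power_mult[of "\<lambda>n. n" "\<lambda>n. (- 1) ^ n * qpoch fps_X (fps_X\<^sup>2) n * inverse (qpoch (- fps_X) fps_X n) :: complex fps"]
      by (simp add: fps_divide_unit qpoch_nth_0 mult_ac)
  qed (intro reduces_to_intros; simp add: qpoch_nth_0)
  thus ?thesis
    using fps_suminf_lambda by (simp flip: Q_def R_def iQ_def)
qed

lemma reduces_to_two_mu_6: "reduces_to two_mu_6 ((inverse E)\<^sup>2)"
proof -
  have "reduces_to two_mu_6 (1 + fps_suminf (\<lambda>n. ((- 1) ^ n * q ^ (n + 1) * (1 + q ^ n) * qpoch q (q\<^sup>2) n) * inverse (qpoch (- q) q (n + 1))))"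
    unfolding two_mu_6_def
  proof (intro reduces_to_add reduces_to_1 reduces_to_suminf)
    show "ascending (\<lambda>n. ((- 1) ^ n * fps_X ^ (n + 1) * (1 + fps_X ^ n) * qpoch fps_X (fps_X\<^sup>2) n) / qpoch (- fps_X) fps_X (n + 1) :: complex fps)"
      using ascending_X_power_mult[of "\<lambda>n. n + 1" "\<lambda>n. (- 1) ^ n * (1 + fps_X ^ n) * qpoch fps_X (fps_X\<^sup>2) n * inverse (qpoch (- fps_X) fps_X (n + 1)) :: complex fps"]
      by (simp add: fps_divide_unit qpoch_nth_0 mult_ac)
  qed (intro reduces_to_intros; simp add: qpoch_nth_0)
  thus ?thesis
    using fps_suminf_mu by (simp flip: Q_def R_def iQ_def)
qed

subsection \<open>Partitions\<close>

definition parts_upto :: "nat \<Rightarrow> nat \<Rightarrow> nat multiset set" where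
  "parts_upto m n = {M. set_mset M \<subseteq> {1..m} \<and> sum_mset M = n}"

lemma parts_upto_0: "parts_upto 0 n = (if n = 0 then {{#}} else {})"
  by (auto simp: parts_upto_def)

text \<open>Either \<open>Suc m\<close> is not a part, or one copy of it can be removed.\<close>

lemma parts_upto_Suc:
  "parts_upto (Suc m) n = parts_upto m n \<union> (if Suc m \<le> n then add_mset (Suc m) ` parts_upto (Suc m) (n - Suc m) else {})"
proof (intro equalityI subsetI)
  fix M assume M: "M \<in> parts_upto (Suc m) n"
  show "M \<in> parts_upto m n \<union> (if Suc m \<le> n then add_mset (Suc m) ` parts_upto (Suc m) (n - Suc m) else {})"
  proof (cases "Suc m \<in># M")
    case True
    then obtain N where N: "M = add_mset (Suc m) N"
      by (metis insert_DiffM)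
    have "N \<in> parts_upto (Suc m) (n - Suc m)" "Suc m \<le> n"
      using M N by (auto simp: parts_upto_def)
    thus ?thesis using N by auto
  next
    case False
    thus ?thesis using M by (auto simp: parts_upto_def le_Suc_eq subset_iff)
  qed
next
  fix M assume "M \<in> parts_upto m n \<union> (if Suc m \<le> n then add_mset (Suc m) ` parts_upto (Suc m) (n - Suc m) else {})"
  thus "M \<in> parts_upto (Suc m) n"
    by (auto simp: parts_upto_def subset_iff split: if_splits)
qed

lemma finite_parts_upto: "finite (parts_upto m n)"
proof (induction m arbitrary: n)
  case (Suc m)
  show ?case
  proof (induction n rule: less_induct)
    case (less n)
    thus ?case by (subst parts_upto_Suc) (auto intro: Suc)
  qed
qed (simp add: parts_upto_0)

lemma card_parts_upto_Suc:
  "card (parts_upto (Suc m) n) = card (parts_upto m n) + (if Suc m \<le> n then card (parts_upto (Suc m) (n - Suc m)) else 0)"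
proof -
  let ?B = "add_mset (Suc m) ` parts_upto (Suc m) (n - Suc m)"
  have "card ?B = card (parts_upto (Suc m) (n - Suc m))"
    by (rule card_image) (simp add: inj_on_def)
  moreover have "Suc m \<notin># M" if "M \<in> parts_upto m n" for M
  proof
    assume "Suc m \<in># M"
    with that have "Suc m \<in> {1..m}" unfolding parts_upto_def by blast
    thus False by simp
  qed
  hence "parts_upto m n \<inter> ?B = {}"
    by (metis disjoint_iff imageE union_single_eq_member)
  hence "card (parts_upto m n \<union> ?B) = card (parts_upto m n) + card ?B"
    by (rule card_Un_disjoint[OF finite_parts_upto finite_imageI[OF finite_parts_upto]])
  moreover have "card (parts_upto (Suc m) n) = card (parts_upto m n \<union> (if Suc m \<le> n then ?B else {}))"
    by (rule arg_cong[OF parts_upto_Suc])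
  ultimately show ?thesis
    by (cases "Suc m \<le> n") (simp_all only: if_True if_False Un_empty_right add_0_right)
qed

text \<open>The recursion for bounded partitions says
  \<open>A m = A (m + 1) * (1 + q ^ (m + 1))\<close>, which makes \<open>A m\<close> the inverse of
  \<open>Q m\<close>.\<close>

lemma iQ_nth: "fps_nth (iQ m) n = of_nat (card (parts_upto m n))"
proof -
  define A where "A = (\<lambda>m. Abs_fps (\<lambda>n. of_nat (card (parts_upto m n))) :: bit fps)"
  have "A m * Q m = 1"
  proof (induction m)
    case 0
    show ?case by (simp add: A_def fps_eq_iff parts_upto_0)
  next
    case (Suc m)
    have "fps_nth (A (Suc m)) n = fps_nth (A m) n + (if n < Suc m then 0 else fps_nth (A (Suc m)) (n - Suc m))" for n
      unfolding A_def fps_nth_Abs_fps by (subst card_parts_upto_Suc) simp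
    hence *: "A (Suc m) = A m + q ^ Suc m * A (Suc m)"
      by (simp add: fps_eq_iff fps_X_power_mult_nth del: power_Suc)
    have "A (Suc m) + q ^ Suc m * A (Suc m) = A m + (q ^ Suc m * A (Suc m) + q ^ Suc m * A (Suc m))"
      unfolding add.assoc[symmetric] by (simp only: *[symmetric])
    hence "A m = A (Suc m) + q ^ Suc m * A (Suc m)"
      by (simp only: bit_fps_add_self add_0_right)
    also have "\<dots> = A (Suc m) * (1 + q * q ^ m)"
      by (simp add: algebra_simps)
    finally show ?case using Suc by (simp add: Q_Suc mult_ac)
  qed
  hence "A m * Q m * iQ m = iQ m"
    by simp
  hence "A m = iQ m"
    unfolding mult.assoc by simp
  thus ?thesis by (simp add: A_def fps_eq_iff)
qed

lemma inverse_E_nth: "fps_nth (inverse E) n = of_nat (partition_count n)"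
proof -
  have "{M. 0 \<notin># M \<and> sum_mset M = n} = parts_upto n n"
  proof -
    have "x \<le> sum_mset M" if "x \<in># M" for x and M :: "nat multiset"
      using multi_member_split[OF that] by auto
    hence "set_mset M \<subseteq> {1..n} \<longleftrightarrow> 0 \<notin># M" if "sum_mset M = n" for M :: "nat multiset"
      using that by (auto simp: subset_iff Suc_le_eq intro: gr0I)
    thus ?thesis
      unfolding parts_upto_def by blast
  qed
  moreover have "fps_nth (inverse E) n = fps_nth (iQ n) n"
    using iQ_agree[of n n] by (simp add: fps_agree_def)
  ultimately show ?thesis
    by (simp add: partition_count_def iQ_nth)
qed

lemma reduces_to_partition_count:
  "reduces_to (Abs_fps (\<lambda>n. of_nat (partition_count n))) (inverse E)"
  unfolding reduces_to_def by (auto simp: inverse_E_nth intro!: exI[of _ "int _"])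

subsection \<open>The \<open>q\<close>-expansions of the eta quotients\<close>

definition euler_phi :: "complex \<Rightarrow> complex" where "euler_phi z = qpoch_inf z z"

definition euler_fps :: "complex fps" where
  "euler_fps = Abs_fps (\<lambda>n. fps_nth (qpoch fps_X fps_X n) n)"

lemma convergent_prod_euler:
  assumes "norm (z::complex) < 1"
  shows "convergent_prod (\<lambda>k. 1 - z * z ^ k)"
  using assms
  by (intro abs_convergent_prod_imp_convergent_prod summable_imp_abs_convergent_prod)
    (simp add: norm_mult norm_power summable_mult summable_geometric)

lemma euler_phi_nonzero:
  assumes "norm z < 1"
  shows "euler_phi z \<noteq> 0"
  unfolding euler_phi_def qpoch_inf_def
proof (rule prodinf_nonzero[OF convergent_prod_euler[OF assms]])
  fix k
  have "norm (z * z ^ k) < 1"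
    using power_Suc_less_one[of "norm z" k] assms
    by (cases "z = 0") (simp_all add: norm_mult norm_power)
  thus "1 - z * z ^ k \<noteq> 0"
    by (metis eq_iff_diff_eq_0 less_irrefl norm_one)
qed

text \<open>Weierstrass test with the majorant \<open>r ^ (n + 1)\<close>. Uniformity yields both
  the holomorphy of \<open>euler_phi\<close> and the identification of its power series.\<close>

lemma uniform_limit_euler_phi:
  assumes "0 \<le> r" "r < 1"
  shows "uniform_limit (cball 0 r) (\<lambda>n z. qpoch z z n) euler_phi sequentially"
proof -
  have "uniformly_convergent_on (cball 0 r) (\<lambda>n z::complex. \<Prod>k<n. 1 + (- (z * z ^ k)))"
  proof (rule uniformly_convergent_on_prod)
    show "uniformly_convergent_on (cball 0 r) (\<lambda>N z::complex. \<Sum>n<N. norm (- (z * z ^ n)))"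
    proof (rule Weierstrass_m_test')
      fix n and z :: complex assume "z \<in> cball 0 r"
      hence "norm z \<le> r" by simp
      thus "norm (norm (- (z * z ^ n))) \<le> r * r ^ n"
        using assms by (simp add: norm_mult norm_power mult_mono power_mono)
    qed (use assms in \<open>simp add: summable_mult summable_geometric\<close>)
  qed (auto intro!: continuous_intros)
  hence "uniformly_convergent_on (cball 0 r) (\<lambda>n z::complex. qpoch z z n)"
    by (simp add: qpoch_def)
  hence "uniform_limit (cball 0 r) (\<lambda>n z::complex. qpoch z z n) (\<lambda>z. lim (\<lambda>n. qpoch z z n)) sequentially"
    by (simp add: uniformly_convergent_uniform_limit_iff)
  moreover have "lim (\<lambda>n. qpoch z z n) = euler_phi z" if "z \<in> cball 0 r" for z
  proof -
    have "(\<lambda>n. \<Prod>i\<le>n. 1 - z * z ^ i) \<longlonglongrightarrow> euler_phi z"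
      unfolding euler_phi_def qpoch_inf_def
      by (intro convergent_prod_LIMSEQ convergent_prod_euler) (use that assms in auto)
    hence "(\<lambda>n. qpoch z z n) \<longlonglongrightarrow> euler_phi z"
      unfolding qpoch_def by (subst LIMSEQ_lessThan_iff_atMost)
    thus ?thesis by (rule limI)
  qed
  ultimately show ?thesis
    by (metis (mono_tags, lifting) uniform_limit_cong')
qed

lemma holomorphic_qpoch: "(\<lambda>z. qpoch z z n) holomorphic_on A"
  unfolding qpoch_def by (intro holomorphic_intros)

lemma holomorphic_euler_phi: "euler_phi holomorphic_on ball 0 1"
proof (rule holomorphic_uniform_sequence[OF _ holomorphic_qpoch])
  fix x :: complex assume x: "x \<in> ball 0 1"
  define d where "d = (1 - norm x) / 2"
  have d: "0 < d" "norm x + d < 1" using x by (auto simp: d_def field_simps)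
  have sub: "cball x d \<subseteq> cball 0 (norm x + d)"
  proof
    fix y assume "y \<in> cball x d"
    thus "y \<in> cball 0 (norm x + d)"
      using norm_triangle_ineq2[of y x] by (simp add: dist_norm norm_minus_commute)
  qed
  have "uniform_limit (cball x d) (\<lambda>n z. qpoch z z n) euler_phi sequentially"
    by (rule uniform_limit_on_subset[OF uniform_limit_euler_phi sub]) (use d in auto)
  moreover have "cball x d \<subseteq> ball 0 1"
    using sub d by (auto simp: subset_iff)
  ultimately show "\<exists>d. 0 < d \<and> cball x d \<subseteq> ball 0 1 \<and>
      uniform_limit (cball x d) (\<lambda>n z. qpoch z z n) euler_phi sequentially"
    using d by blast
qed simp

lemma euler_fps_tendsto: "(\<lambda>n. qpoch fps_X fps_X n) \<longlonglongrightarrow> euler_fps"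
proof (rule tendsto_fpsI)
  fix N
  have "fps_nth (qpoch fps_X fps_X (N + k)) N = fps_nth (qpoch fps_X fps_X N :: complex fps) N" for k
  proof (induction k)
    case (Suc k)
    have "qpoch fps_X fps_X (N + Suc k) = qpoch fps_X fps_X (N + k) -
        fps_X ^ Suc (N + k) * (qpoch fps_X fps_X (N + k) :: complex fps)"
      by (simp add: qpoch_Suc algebra_simps)
    thus ?case using Suc by (simp add: fps_X_power_mult_nth del: power_Suc)
  qed auto
  hence "fps_nth (qpoch fps_X fps_X n) N = fps_nth euler_fps N" if "N \<le> n" for n
    using that by (metis euler_fps_def fps_nth_Abs_fps le_add_diff_inverse)
  thus "\<forall>\<^sub>F n in sequentially. fps_nth (qpoch fps_X fps_X n) N = fps_nth euler_fps N"
    by (auto simp: eventually_sequentially)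
qed

text \<open>The partial products converge uniformly near 0 as functions and coefficientwise as
  formal series, so the two limits correspond.\<close>

lemma euler_phi_fps_expansion: "euler_phi has_fps_expansion euler_fps"
proof -
  have exp: "euler_phi has_fps_expansion fps_expansion euler_phi 0"
    by (intro has_fps_expansion_fps_expansion[OF _ _ holomorphic_euler_phi]) auto
  have "fps_expansion euler_phi 0 = euler_fps"
  proof (rule uniform_limit_imp_fps_expansion_eq[OF euler_fps_tendsto _ _ exp])
    show "uniform_limit (ball 0 (1 / 2)) (\<lambda>n z. qpoch z z n) euler_phi sequentially"
      by (rule uniform_limit_on_subset[OF uniform_limit_euler_phi[of "1 / 2"]]) auto
    show "\<forall>\<^sub>F n in sequentially. (\<lambda>z. qpoch z z n) has_fps_expansion (qpoch fps_X fps_X n :: complex fps)"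
      unfolding qpoch_def by (intro always_eventually allI fps_expansion_intros)
    show "\<forall>\<^sub>F n in sequentially. (\<lambda>z. qpoch z z n) holomorphic_on ball 0 (1 / 2)"
      by (intro always_eventually allI holomorphic_qpoch)
  qed auto
  thus ?thesis using exp by simp
qed

lemma euler_fps_nth_0 [simp]: "fps_nth euler_fps 0 = 1"
  by (simp add: euler_fps_def)

lemma reduces_to_euler_fps: "reduces_to euler_fps E"
  unfolding reduces_to_def euler_fps_def E_def Q_def fps_nth_Abs_fps
  by (intro allI reduces_toD reduces_to_qpoch reduces_to_X)

lemma norm_nome_less_1: "Im \<tau> > 0 \<Longrightarrow> norm (nome \<tau>) < 1"
  by (simp add: nome_def)

text \<open>Holomorphy on the unit disc makes the expansion converge at every nome. Division by the
  nome turns the constant coefficient 1 into the pole and shifts the index by one.\<close>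

lemma has_q_expansion_holomorphic:
  assumes "g holomorphic_on ball 0 1" "g has_fps_expansion G" "fps_nth G 0 = 1"
    and "\<And>\<tau>. Im \<tau> > 0 \<Longrightarrow> f \<tau> = g (nome \<tau>) / nome \<tau>"
  shows "has_q_expansion f (\<lambda>n. fps_nth G (n + 1))"
  unfolding has_q_expansion_def
proof (intro allI impI)
  fix \<tau> :: complex assume \<tau>: "Im \<tau> > 0"
  define z where "z = nome \<tau>"
  have z: "z \<noteq> 0" "norm z < 1"
    using norm_nome_less_1[OF \<tau>] by (auto simp: z_def nome_def)
  have "(\<lambda>n. fps_nth G n * z ^ n) sums g z"
    by (rule has_fps_expansion_imp_sums_complex[OF assms(2), of 1]) (use assms(1) z in \<open>auto simp: one_ereal_def\<close>)
  hence "(\<lambda>n. fps_nth G (Suc n) * z ^ Suc n) sums (g z - 1)"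
    using assms(3) by (subst sums_Suc_iff) simp
  hence "(\<lambda>n. fps_nth G (Suc n) * z ^ Suc n / z) sums ((g z - 1) / z)"
    by (rule sums_divide)
  thus "(\<lambda>n. fps_nth G (n + 1) * nome \<tau> ^ n) sums (f \<tau> - inverse (nome \<tau>))"
    using z assms(4)[OF \<tau>] by (simp add: z_def[symmetric] field_simps)
qed

section \<open>Eta quotients as power series in the nome\<close>

definition euler_fps_at :: "nat \<Rightarrow> complex fps" where
  "euler_fps_at k = euler_fps oo fps_X ^ k"

lemma euler_fps_at_nth_0 [simp]: "fps_nth (euler_fps_at k) 0 = 1"
  by (simp add: euler_fps_at_def)

lemma euler_phi_power_fps_expansion:
  assumes "k > 0"
  shows "(\<lambda>z. euler_phi (z ^ k)) has_fps_expansion euler_fps_at k"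
proof -
  have "(euler_phi \<circ> (\<lambda>z. z ^ k)) has_fps_expansion euler_fps_at k"
    unfolding euler_fps_at_def
    by (rule has_fps_expansion_compose[OF euler_phi_fps_expansion has_fps_expansion_fps_X_power])
      (use assms in simp)
  thus ?thesis by (simp add: o_def)
qed

lemma power_in_unit_disc:
  "k > 0 \<Longrightarrow> z \<in> ball 0 1 \<Longrightarrow> z ^ k \<in> ball (0::complex) 1"
  using power_less_one_iff[of "norm z" k] by (simp add: norm_power)

lemma holomorphic_euler_phi_power:
  assumes "k > 0"
  shows "(\<lambda>z. euler_phi (z ^ k)) holomorphic_on ball 0 1"
proof -
  have "(euler_phi \<circ> (\<lambda>z. z ^ k)) holomorphic_on ball 0 1"
    by (rule holomorphic_on_compose_gen[OF _ holomorphic_euler_phi])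
      (use power_in_unit_disc[OF assms] in \<open>auto intro!: holomorphic_intros\<close>)
  thus ?thesis by (simp add: o_def)
qed

lemma euler_phi_power_nonzero: "k > 0 \<Longrightarrow> norm z < 1 \<Longrightarrow> euler_phi (z ^ k) \<noteq> 0"
  using power_in_unit_disc[of k z] by (intro euler_phi_nonzero) auto

lemma eta_conv_euler_phi:
  "eta k \<tau> = exp (2 * of_real pi * \<i> * \<tau> / 24) ^ k * euler_phi (nome \<tau> ^ k)"
  by (simp add: eta_def euler_phi_def mult_ac flip: exp_of_nat_mult)

lemma nome_conv_power: "nome \<tau> = exp (2 * of_real pi * \<i> * \<tau> / 24) ^ 24"
  by (simp add: nome_def mult_ac flip: exp_of_nat_mult)

lemma has_q_expansion_j3:
  "has_q_expansion j3 (\<lambda>n. fps_nth (euler_fps_at 1 ^ 12 / euler_fps_at 3 ^ 12) (n + 1))"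
proof (rule has_q_expansion_holomorphic)
  show "(\<lambda>z. euler_phi (z ^ 1) ^ 12 / euler_phi (z ^ 3) ^ 12) holomorphic_on ball 0 1"
    by (intro holomorphic_on_divide holomorphic_on_power holomorphic_euler_phi_power)
      (simp_all add: euler_phi_power_nonzero euler_phi_nonzero)
  show "(\<lambda>z. euler_phi (z ^ 1) ^ 12 / euler_phi (z ^ 3) ^ 12) has_fps_expansion euler_fps_at 1 ^ 12 / euler_fps_at 3 ^ 12"
    by (intro has_fps_expansion_divide' has_fps_expansion_power euler_phi_power_fps_expansion)
      (auto simp: fps_power_zeroth)
  show "j3 \<tau> = euler_phi (nome \<tau> ^ 1) ^ 12 / euler_phi (nome \<tau> ^ 3) ^ 12 / nome \<tau>" for \<tau>
  proof -
    \<comment> \<open>\<open>e\<close> is a 24th root of the nome; \<open>e ^ 12\<close> above and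
      \<open>e ^ 36\<close> below leave \<open>e ^ 24\<close> in the denominator.\<close>
    define e where "e = exp (2 * of_real pi * \<i> * \<tau> / 24)"
    have "e \<noteq> 0" by (simp add: e_def)
    thus ?thesis
      unfolding j3_def eta_conv_euler_phi e_def[symmetric] nome_conv_power
      by (simp add: power_mult_distrib divide_simps flip: power_mult power_add)
  qed
qed (simp add: fps_divide_unit fps_power_zeroth)

lemma has_q_expansion_j6:
  "has_q_expansion j6 (\<lambda>n. fps_nth (euler_fps_at 2 ^ 3 * euler_fps_at 3 ^ 9 / (euler_fps_at 1 ^ 3 * euler_fps_at 6 ^ 9)) (n + 1))"
proof (rule has_q_expansion_holomorphic)
  show "(\<lambda>z. euler_phi (z ^ 2) ^ 3 * euler_phi (z ^ 3) ^ 9 / (euler_phi (z ^ 1) ^ 3 * euler_phi (z ^ 6) ^ 9)) holomorphic_on ball 0 1"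
    by (intro holomorphic_on_divide holomorphic_on_mult holomorphic_on_power holomorphic_euler_phi_power)
      (simp_all add: euler_phi_power_nonzero euler_phi_nonzero)
  show "(\<lambda>z. euler_phi (z ^ 2) ^ 3 * euler_phi (z ^ 3) ^ 9 / (euler_phi (z ^ 1) ^ 3 * euler_phi (z ^ 6) ^ 9))
      has_fps_expansion euler_fps_at 2 ^ 3 * euler_fps_at 3 ^ 9 / (euler_fps_at 1 ^ 3 * euler_fps_at 6 ^ 9)"
    by (intro has_fps_expansion_divide' has_fps_expansion_mult has_fps_expansion_power euler_phi_power_fps_expansion)
      (auto simp: fps_power_zeroth)
  show "j6 \<tau> = euler_phi (nome \<tau> ^ 2) ^ 3 * euler_phi (nome \<tau> ^ 3) ^ 9 / (euler_phi (nome \<tau> ^ 1) ^ 3 * euler_phi (nome \<tau> ^ 6) ^ 9) / nome \<tau>" for \<tau>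
  proof -
    \<comment> \<open>The exponents of \<open>e\<close> are 6 + 27 above and 3 + 54 below, again a
      net 24 below.\<close>
    define e where "e = exp (2 * of_real pi * \<i> * \<tau> / 24)"
    have "e \<noteq> 0" by (simp add: e_def)
    thus ?thesis
      unfolding j6_def eta_conv_euler_phi e_def[symmetric] nome_conv_power
      by (simp add: power_mult_distrib divide_simps flip: power_mult power_add)
  qed
qed (simp add: fps_divide_unit fps_power_zeroth)

lemma has_q_expansion_j12:
  "has_q_expansion j12 (\<lambda>n. fps_nth (euler_fps_at 4 ^ 4 * euler_fps_at 6 ^ 2 / (euler_fps_at 2 ^ 2 * euler_fps_at 12 ^ 4)) (n + 1))"
proof (rule has_q_expansion_holomorphic)
  show "(\<lambda>z. euler_phi (z ^ 4) ^ 4 * euler_phi (z ^ 6) ^ 2 / (euler_phi (z ^ 2) ^ 2 * euler_phi (z ^ 12) ^ 4)) holomorphic_on ball 0 1"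
    by (intro holomorphic_on_divide holomorphic_on_mult holomorphic_on_power holomorphic_euler_phi_power)
      (simp_all add: euler_phi_power_nonzero euler_phi_nonzero)
  show "(\<lambda>z. euler_phi (z ^ 4) ^ 4 * euler_phi (z ^ 6) ^ 2 / (euler_phi (z ^ 2) ^ 2 * euler_phi (z ^ 12) ^ 4))
      has_fps_expansion euler_fps_at 4 ^ 4 * euler_fps_at 6 ^ 2 / (euler_fps_at 2 ^ 2 * euler_fps_at 12 ^ 4)"
    by (intro has_fps_expansion_divide' has_fps_expansion_mult has_fps_expansion_power euler_phi_power_fps_expansion)
      (auto simp: fps_power_zeroth)
  show "j12 \<tau> = euler_phi (nome \<tau> ^ 4) ^ 4 * euler_phi (nome \<tau> ^ 6) ^ 2 / (euler_phi (nome \<tau> ^ 2) ^ 2 * euler_phi (nome \<tau> ^ 12) ^ 4) / nome \<tau>" for \<tau>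
  proof -
    \<comment> \<open>The exponents of \<open>e\<close> are 16 + 12 above and 4 + 48 below.\<close>
    define e where "e = exp (2 * of_real pi * \<i> * \<tau> / 24)"
    have "e \<noteq> 0" by (simp add: e_def)
    thus ?thesis
      unfolding j12_def eta_conv_euler_phi e_def[symmetric] nome_conv_power
      by (simp add: power_mult_distrib divide_simps flip: power_mult power_add)
  qed
qed (simp add: fps_divide_unit fps_power_zeroth)

subsection \<open>Dissections of the Hauptmoduln modulo 2\<close>

lemma inverse_E_compose: "inverse E oo q ^ 3 = inverse E3"
proof -
  have "(inverse E oo q ^ 3) * E3 = (inverse E * E) oo q ^ 3"
    unfolding E3_def by (rule fps_compose_mult_distrib[symmetric]) simp
  hence "(inverse E oo q ^ 3) * E3 * inverse E3 = inverse E3"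
    by simp
  thus ?thesis unfolding mult.assoc by simp
qed

definition W :: "bit fps" where "W = E ^ 3 * (inverse E3) ^ 3"
definition Z :: "bit fps" where "Z = E3 ^ 3 * (inverse E) ^ 3"

text \<open>Divide \<open>E_cubed_dissection\<close> by \<open>E3 ^ 3\<close>, a series in
  \<open>q ^ 3\<close>; its two summands are the residue classes 0 and 1.\<close>

lemma W_dissection: "W = ((inverse E)\<^sup>2 oo q ^ 3) + q * (Z oo q ^ 3)"
proof -
  have "W = E3 * (inverse E3) ^ 3 + q * ((E3 oo q ^ 3) ^ 3 * (inverse E3) ^ 3)"
    unfolding W_def E_cubed_dissection by (simp add: algebra_simps)
  also have "E3 * (inverse E3) ^ 3 = (E3 * inverse E3) * (inverse E3)\<^sup>2"
    by (simp only: power3_eq_cube power2_eq_square ac_simps)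
  also have "\<dots> = (inverse E)\<^sup>2 oo q ^ 3"
    by (simp add: fps_compose_power[symmetric] inverse_E_compose)
  also have "(E3 oo q ^ 3) ^ 3 * (inverse E3) ^ 3 = Z oo q ^ 3"
    unfolding Z_def by (simp add: fps_compose_mult_distrib fps_compose_power[symmetric] inverse_E_compose)
  finally show ?thesis .
qed

lemma W_nth_0_mod_3: "fps_nth W (3 * n) = fps_nth ((inverse E)\<^sup>2) n"
proof -
  have "\<not> 3 dvd 3 * n - Suc 0" if "n > 0" using that by presburger
  thus ?thesis by (simp add: W_dissection fps_nth_compose_X_power)
qed

lemma W_nth_1_mod_3: "fps_nth W (3 * n + 1) = fps_nth Z n"
proof -
  have "\<not> 3 dvd Suc (3 * n)" by presburger
  thus ?thesis by (simp add: W_dissection fps_nth_compose_X_power)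
qed

lemma W_nth_2_mod_3: "fps_nth W (3 * n + 2) = 0"
proof -
  have "\<not> 3 dvd Suc (Suc (3 * n))" "\<not> 3 dvd Suc (3 * n)" by presburger+
  thus ?thesis by (simp add: W_dissection fps_nth_compose_X_power)
qed

text \<open>Write \<open>Z\<close> as \<open>E ^ 3 * E3 ^ 3 / E ^ 6\<close> and apply
  \<open>E_E3_identity\<close>. Both resulting quotients consist of even powers, so they are squares
  and hence series in \<open>q ^ 2\<close>.\<close>

lemma Z_dissection: "Z = psi\<^sup>2 + q * (E3 ^ 6 * (inverse E) ^ 3)\<^sup>2"
proof -
  have "Z = E3 ^ 3 * (E * inverse E) ^ 3 * (inverse E) ^ 3"
    by (simp add: Z_def)
  also have "\<dots> = (E ^ 3 * E3 ^ 3) * (inverse E) ^ 6"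
    unfolding power_mult_distrib by (simp add: mult_ac flip: power_add)
  also have "\<dots> = E ^ 12 * (inverse E) ^ 6 + q * (E3 ^ 12 * (inverse E) ^ 6)"
    unfolding E_E3_identity by (simp add: algebra_simps)
  also have "E ^ 12 * (inverse E) ^ 6 = E ^ 6 * (E * inverse E) ^ 6"
    unfolding power_mult_distrib mult.assoc[symmetric] by (simp flip: power_add)
  also have "\<dots> = psi\<^sup>2"
    by (simp flip: E_cubed power_mult)
  also have "E3 ^ 12 * (inverse E) ^ 6 = (E3 ^ 6 * (inverse E) ^ 3)\<^sup>2"
    by (simp add: power_mult_distrib flip: power_mult)
  finally show ?thesis .
qed

lemma Z_nth_even: "fps_nth Z (2 * n) = fps_nth psi n"
  by (cases n) (simp_all add: Z_dissection bit_fps_square_nth)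

lemma Z_nth_odd: "fps_nth Z (2 * n + 1) = fps_nth (E3 ^ 6 * (inverse E) ^ 3) n"
  by (simp add: Z_dissection bit_fps_square_nth)

section \<open>Reduction of the eta quotients\<close>

lemma E_compose:
  "E oo q ^ 1 = E" "E oo q ^ 2 = E\<^sup>2" "E oo q ^ 4 = E ^ 4"
  "E oo q ^ 6 = E3\<^sup>2" "E oo q ^ 12 = E3 ^ 4"
proof -
  have 2: "f oo q ^ (k * 2) = (f oo q ^ k)\<^sup>2" if "k > 0" for f :: "bit fps" and k
    using that by (subst bit_fps_square)
      (simp add: fps_compose_assoc[symmetric] X_power_compose_X_power mult.commute)
  show 1: "E oo q ^ 1 = E" by simp
  show "E oo q ^ 2 = E\<^sup>2" using 2[of 1 E] 1 by simp
  show "E oo q ^ 4 = E ^ 4" using 2[of 2 E] 2[of 1 E] by (simp flip: power_mult)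
  show "E oo q ^ 6 = E3\<^sup>2" using 2[of 3 E] by (simp add: E3_def)
  show "E oo q ^ 12 = E3 ^ 4" using 2[of 6 E] 2[of 3 E] by (simp add: E3_def flip: power_mult)
qed

lemma reduces_to_euler_fps_at: "k > 0 \<Longrightarrow> reduces_to (euler_fps_at k) (E oo q ^ k)"
  unfolding euler_fps_at_def by (intro reduces_to_compose_X_power reduces_to_euler_fps)

lemma W_power4: "W ^ 4 = E ^ 12 * (inverse E3) ^ 12"
  by (simp add: W_def power_mult_distrib flip: power_mult)

lemma reduces_to_j3: "reduces_to (euler_fps_at 1 ^ 12 / euler_fps_at 3 ^ 12) (W ^ 4)"
proof -
  have "reduces_to (euler_fps_at 1 ^ 12 / euler_fps_at 3 ^ 12) ((E oo q ^ 1) ^ 12 * inverse ((E oo q ^ 3) ^ 12))"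
    by (intro reduces_to_divide reduces_to_power reduces_to_euler_fps_at) (simp_all add: fps_power_zeroth)
  also have "(E oo q ^ 1) ^ 12 * inverse ((E oo q ^ 3) ^ 12) = W ^ 4"
    unfolding E_compose E3_def[symmetric] W_power4 fps_inverse_power ..
  finally show ?thesis .
qed

text \<open>Frobenius gives \<open>E ^ 16 * E3 ^ 4 / (E ^ 4 * E3 ^ 16)\<close>, the same quotient as
  for \<open>j3\<close>.\<close>

lemma reduces_to_j12:
  "reduces_to (euler_fps_at 4 ^ 4 * euler_fps_at 6 ^ 2 / (euler_fps_at 2 ^ 2 * euler_fps_at 12 ^ 4)) (W ^ 4)"
proof -
  have "reduces_to (euler_fps_at 4 ^ 4 * euler_fps_at 6 ^ 2 / (euler_fps_at 2 ^ 2 * euler_fps_at 12 ^ 4))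
      ((E oo q ^ 4) ^ 4 * (E oo q ^ 6) ^ 2 * inverse ((E oo q ^ 2) ^ 2 * (E oo q ^ 12) ^ 4))"
    by (intro reduces_to_divide reduces_to_mult reduces_to_power reduces_to_euler_fps_at)
      (simp_all add: fps_power_zeroth)
  also have "(E oo q ^ 4) ^ 4 * (E oo q ^ 6) ^ 2 * inverse ((E oo q ^ 2) ^ 2 * (E oo q ^ 12) ^ 4) =
      E ^ 16 * (inverse E) ^ 4 * (E3 ^ 4 * (inverse E3) ^ 16)"
    unfolding E_compose by (simp add: fps_inverse_mult fps_inverse_power mult_ac flip: power_mult)
  also have "\<dots> = E ^ 12 * (E * inverse E) ^ 4 * ((E3 * inverse E3) ^ 4 * (inverse E3) ^ 12)"
  proof -
    have "x ^ 16 = x ^ 12 * x ^ 4" for x :: "bit fps" by (simp flip: power_add)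
    thus ?thesis by (simp only: power_mult_distrib ac_simps)
  qed
  also have "\<dots> = W ^ 4" by (simp add: W_power4)
  finally show ?thesis .
qed

text \<open>The quotient collapses to \<open>E ^ 3 * E3 ^ 3 / E3 ^ 12\<close>, to which
  \<open>E_E3_identity\<close> applies. The extra \<open>q\<close> affects only the constant term of
  \<open>j6\<close>.\<close>

lemma reduces_to_j6:
  "reduces_to (euler_fps_at 2 ^ 3 * euler_fps_at 3 ^ 9 / (euler_fps_at 1 ^ 3 * euler_fps_at 6 ^ 9)) (W ^ 4 + q)"
proof -
  have "reduces_to (euler_fps_at 2 ^ 3 * euler_fps_at 3 ^ 9 / (euler_fps_at 1 ^ 3 * euler_fps_at 6 ^ 9))
      ((E oo q ^ 2) ^ 3 * (E oo q ^ 3) ^ 9 * inverse ((E oo q ^ 1) ^ 3 * (E oo q ^ 6) ^ 9))"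
    by (intro reduces_to_divide reduces_to_mult reduces_to_power reduces_to_euler_fps_at)
      (simp_all add: fps_power_zeroth)
  also have "(E oo q ^ 2) ^ 3 * (E oo q ^ 3) ^ 9 * inverse ((E oo q ^ 1) ^ 3 * (E oo q ^ 6) ^ 9) =
      E ^ 6 * (inverse E) ^ 3 * (E3 ^ 9 * (inverse E3) ^ 18)"
    unfolding E_compose E3_def[symmetric]
    by (simp add: fps_inverse_mult fps_inverse_power mult_ac flip: power_mult)
  also have "\<dots> = E ^ 3 * (E * inverse E) ^ 3 * ((E3 * inverse E3) ^ 6 * E3 ^ 3 * (inverse E3) ^ 12)"
  proof -
    have "x ^ 6 = x ^ 3 * x ^ 3" "x ^ 9 = x ^ 6 * x ^ 3" "x ^ 18 = x ^ 6 * x ^ 12" for x :: "bit fps"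
      by (simp_all flip: power_add)
    thus ?thesis by (simp only: power_mult_distrib ac_simps)
  qed
  also have "\<dots> = (E ^ 3 * E3 ^ 3) * (inverse E3) ^ 12" by simp
  also have "\<dots> = W ^ 4 + q * (E3 * inverse E3) ^ 12"
    unfolding E_E3_identity W_power4 power_mult_distrib by (simp only: distrib_right mult.assoc)
  also have "\<dots> = W ^ 4 + q" by simp
  finally show ?thesis .
qed

theorem theorem1p2:
  shows
    "(\<forall>n\<ge>1. [c3 n \<equiv> c6 n] (mod 2) \<and> [c6 n \<equiv> c12 n] (mod 2)) \<and>
     (\<forall>n\<ge>1. [c3 (2 * n) \<equiv> 0] (mod 2)) \<and>
     (\<forall>n. [c3 (4 * n + 1) \<equiv> 0] (mod 2) \<and> [c3 (12 * n + 7) \<equiv> 0] (mod 2) \<and>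
          [c3 (24 * n + 11) \<equiv> 0] (mod 2)) \<and>
     (\<forall>n\<ge>1. [c3 (24 * n - 1) \<equiv> fps_nth f_3 n] (mod 2) \<and>
            [fps_nth f_3 n \<equiv> fps_nth phi_3 n] (mod 2) \<and>
            [fps_nth phi_3 n \<equiv> fps_nth phi_6 n] (mod 2) \<and>
            [fps_nth phi_6 n \<equiv> fps_nth two_mu_6 (2 * n)] (mod 2) \<and>
            [fps_nth two_mu_6 (2 * n) \<equiv> of_nat (partition_count n)] (mod 2)) \<and>
     (\<forall>n\<ge>1. [c3 (24 * n - 9) \<equiv> fps_nth psi_6 n] (mod 2)) \<and>
     (\<forall>n. [c3 (24 * n + 3) \<equiv> 1] (mod 2) \<longleftrightarrow> (\<exists>k. n = k * (k + 1) div 2)) \<and>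
     (\<forall>n. [c3 (12 * n + 3) \<equiv> fps_nth lambda_6 n] (mod 2))"
proof -
  note c3 = fourier_coeff_eqI[OF has_q_expansion_j3]
  note c6 = fourier_coeff_eqI[OF has_q_expansion_j6]
  note c12 = fourier_coeff_eqI[OF has_q_expansion_j12]
  \<comment> \<open>\<open>c3 m\<close> corresponds to coefficient \<open>m + 1\<close> of
    \<open>W ^ 4\<close>, so it can be odd only for \<open>m\<close> congruent to 3 modulo
    4.\<close>
  have zero: "[c3 m \<equiv> 0] (mod 2) \<longleftrightarrow> fps_nth (W ^ 4) (m + 1) = 0" for m
    using ccong_iff_bit[OF reduces_to_j3 reduces_to_0, of "m + 1" 0] unfolding c3 by simp
  have one: "[c3 m \<equiv> 1] (mod 2) \<longleftrightarrow> fps_nth (W ^ 4) (m + 1) = 1" for m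
    using ccong_iff_bit[OF reduces_to_j3 reduces_to_1, of "m + 1" 0] unfolding c3 by simp
  have coeff: "[c3 m \<equiv> fps_nth F n] (mod 2) \<longleftrightarrow> fps_nth (W ^ 4) (m + 1) = fps_nth f n"
    if "reduces_to F f" for F f m n
    using ccong_iff_bit[OF reduces_to_j3 that, of "m + 1" n] unfolding c3 .
  have W4: "fps_nth (W ^ 4) (4 * m) = fps_nth W m" for m
    by (simp add: bit_fps_power4_nth)
  \<comment> \<open>\<open>24 * n = 4 * (3 * (2 * n))\<close>: a fourth power, then class 0 modulo 3
    of \<open>W\<close>, then a square.\<close>
  have W4_0: "fps_nth (W ^ 4) (24 * n) = fps_nth (inverse E) n" for n
    using W4[of "3 * (2 * n)"] W_nth_0_mod_3[of "2 * n"] by (simp add: bit_fps_square_nth)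

  \<comment> \<open>For \<open>n \<ge> 1\<close> the shifted index \<open>n + 1\<close> misses the
    extra \<open>q\<close> of \<open>j6\<close>.\<close>
  have "[c3 n \<equiv> c6 n] (mod 2)" "[c6 n \<equiv> c12 n] (mod 2)" if "n \<ge> 1" for n
    unfolding c3 c6 c12 ccong_iff_bit[OF reduces_to_j3 reduces_to_j6]
      ccong_iff_bit[OF reduces_to_j6 reduces_to_j12]
    using that by simp_all
  moreover have "[c3 (2 * n) \<equiv> 0] (mod 2)" for n
  proof -
    have "\<not> 4 dvd 2 * n + 1" by presburger
    thus ?thesis unfolding zero by (simp add: bit_fps_power4_nth)
  qed
  moreover have "[c3 (4 * n + 1) \<equiv> 0] (mod 2)" for n
  proof -
    have "\<not> 4 dvd 4 * n + 1 + 1" by presburger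
    thus ?thesis unfolding zero by (simp add: bit_fps_power4_nth)
  qed
  \<comment> \<open>The shifted index \<open>4 * (3 * n + 2)\<close> falls into the empty class
    modulo 3.\<close>
  moreover have "[c3 (12 * n + 7) \<equiv> 0] (mod 2)" for n
    using W4[of "3 * n + 2"] W_nth_2_mod_3[of n] by (simp add: zero)
  \<comment> \<open>The shifted index is \<open>4 * (3 * (2 * n + 1))\<close>, which leads to an
    odd-index coefficient of a square.\<close>
  moreover have "[c3 (24 * n + 11) \<equiv> 0] (mod 2)" for n
    using W4[of "3 * (2 * n + 1)"] W_nth_0_mod_3[of "2 * n + 1"]
    by (simp add: zero bit_fps_square_nth)
  moreover have "[c3 (24 * n - 1) \<equiv> fps_nth f_3 n] (mod 2)" if "n \<ge> 1" for n
    using that W4_0[of n] by (simp add: coeff[OF reduces_to_f_3])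
  moreover have "[fps_nth f_3 n \<equiv> fps_nth phi_3 n] (mod 2)"
      "[fps_nth phi_3 n \<equiv> fps_nth phi_6 n] (mod 2)"
      "[fps_nth phi_6 n \<equiv> fps_nth two_mu_6 (2 * n)] (mod 2)" for n
    by (simp_all add: ccong_iff_bit[OF reduces_to_f_3 reduces_to_phi_3]
        ccong_iff_bit[OF reduces_to_phi_3 reduces_to_phi_6]
        ccong_iff_bit[OF reduces_to_phi_6 reduces_to_two_mu_6] bit_fps_square_nth)
  moreover have "[fps_nth two_mu_6 (2 * n) \<equiv> of_nat (partition_count n)] (mod 2)" for n
    using ccong_iff_bit[OF reduces_to_two_mu_6 reduces_to_partition_count, of "2 * n" n]
    by (simp add: bit_fps_square_nth)
  moreover have "[c3 (24 * n - 9) \<equiv> fps_nth psi_6 n] (mod 2)" if n: "n \<ge> 1" for n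
  proof -
    \<comment> \<open>The leading factor \<open>q\<close> in the reduction of \<open>psi_6\<close>
      makes its coefficient \<open>n\<close> the coefficient \<open>m = n - 1\<close> of the other
      factor.\<close>
    obtain m where m: "n = m + 1" using n by (metis add.commute le_Suc_ex plus_1_eq_Suc)
    have "fps_nth (W ^ 4) (24 * n - 9 + 1) = fps_nth (W ^ 4) (4 * (3 * (2 * m + 1) + 1))"
      by (rule arg_cong[where f = "fps_nth _"]) (simp add: m)
    also have "\<dots> = fps_nth (E3 ^ 6 * (inverse E) ^ 3) m"
      unfolding W4 W_nth_1_mod_3 Z_nth_odd ..
    finally show ?thesis unfolding coeff[OF reduces_to_psi_6] by (simp add: m)
  qed
  moreover have "[c3 (24 * n + 3) \<equiv> 1] (mod 2) \<longleftrightarrow> (\<exists>k. n = k * (k + 1) div 2)" for n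
  proof -
    have "fps_nth (W ^ 4) (24 * n + 3 + 1) = fps_nth (W ^ 4) (4 * (3 * (2 * n) + 1))"
      by (rule arg_cong[where f = "fps_nth _"]) simp
    also have "\<dots> = (if \<exists>k. n = tri k then 1 else 0)"
      unfolding W4 W_nth_1_mod_3 Z_nth_even by (rule psi_nth)
    finally show ?thesis unfolding one by (simp add: tri_def)
  qed
  moreover have "[c3 (12 * n + 3) \<equiv> fps_nth lambda_6 n] (mod 2)" for n
  proof -
    have "fps_nth (W ^ 4) (12 * n + 3 + 1) = fps_nth (W ^ 4) (4 * (3 * n + 1))"
      by (rule arg_cong[where f = "fps_nth _"]) simp
    thus ?thesis
      unfolding coeff[OF reduces_to_lambda_6] W4 W_nth_1_mod_3 Z_def .
  qed
  ultimately show ?thesis by blast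
qed

end
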